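(* There are universal constants $c_2,c_3$ and, for each degree $d\ge1$ and each admissible probability distribution on complex polynomials of degree $d$, a constant $c_1$ (depending on $d$ and on the distribution) such that the following holds. Let $f$ be a random complex polynomial of degree $d$, let $b\ge 1+\log_2 d$ and $0<\delta<1$, and let $k$ be an integer with $$k\ \ge\ c_1+c_2\log_2 b-c_3\log_2\delta .$$ Then, with probability (at least) $1-\delta$, $k$ steps of the Renormalized Graeffe Iteration applied to $f$ approximate all the numbers $\log|\zeta_i|$, $1\le i\le d$, with relative precision $2^{-b}$, where $\zeta_1,\dots,\zeta_d$ are the roots of $f$ ordered by decreasing modulus.
   Context: The Graeffe iterate of a degree-$d$ polynomial $f$ is $Gf(x)=(-1)^d f(\sqrt x)f(-\sqrt x)$, a polynomial of degree $d$ whose roots are the squares of the roots of $f$. Write $G^kf(x)=\sum_{j=0}^d a^{(k)}_jx^j$. After $k$ steps, Renormalized Graeffe Iteration (in exact arithmetic) produces the numbers $\hat a^k_j=2^{-k}\log|a^{(k)}_j|$ and $\alpha_j^k=\arg a^{(k)}_j$, $0\le j\le d$. The approximation of $\log|\zeta_{d-j}|$ it provides is $\hat a^k_j-\hat a^k_{j+1}$, $0\le j\le d-1$. Relative precision $2^{-b}$ means that the error is at most $2^{-b}$ times the absolute value of the approximated quantity. Admissible probability distribution: one with bounded Radon-Nikodym derivative with respect to the uniform (Lebesgue) probability on the projectivization of the space of coefficient vectors $(f_0,\dots,f_d)\in\mathbb C^{d+1}$ (for instance the unitarily invariant distribution, in which the $f_i$ are independent complex Gaussians with variance proportional to $\binom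 di$). *)

theory Defs
  imports
    "HOL-Probability.Probability"
    "HOL-Computational_Algebra.Computational_Algebra"
begin

section \<open>Graeffe iteration\<close>

definition graeffe :: "complex poly \<Rightarrow> complex poly" where
  "graeffe f = (THE g. \<forall>x. poly g x =
      (- 1) ^ degree f * poly f (csqrt x) * poly f (- csqrt x))"

lemma poly_even_odd_parts:
  "\<exists>A B. \<forall>x. poly (p :: complex poly) x = poly A (x\<^sup>2) + x * poly B (x\<^sup>2)"
proof (induction p)
  case 0
  show ?case by (rule exI[of _ 0], rule exI[of _ 0]) simp
next
  case (pCons a p)
  then obtain A B where AB: "\<And>x. poly p x = poly A (x\<^sup>2) + x * poly B (x\<^sup>2)" by blast
  show ?case
    by (rule exI[of _ "pCons a B"], rule exI[of _ A])
       (simp add: AB algebra_simps power2_eq_square)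
qed

lemma poly_graeffe:
  "poly (graeffe f) x = (- 1) ^ degree f * poly f (csqrt x) * poly f (- csqrt x)"
proof -
  obtain A B where AB: "\<And>x. poly f x = poly A (x\<^sup>2) + x * poly B (x\<^sup>2)"
    using poly_even_odd_parts by blast
  let ?P = "\<lambda>g. \<forall>x. poly g x = (- 1) ^ degree f * poly f (csqrt x) * poly f (- csqrt x)"
  have "?P (smult ((- 1) ^ degree f) (A * A - [:0, 1:] * B * B))"
  proof
    fix x :: complex
    define s where "s = csqrt x"
    have x: "x = s\<^sup>2" by (simp add: s_def)
    have "poly f (csqrt x) * poly f (- csqrt x) = poly A x * poly A x - x * poly B x * poly B x"
      unfolding s_def[symmetric] AB power2_minus x[symmetric]
      by (subst (5) x) (simp add: algebra_simps power2_eq_square)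
    then show "poly (smult ((- 1) ^ degree f) (A * A - [:0, 1:] * B * B)) x =
        (- 1) ^ degree f * poly f (csqrt x) * poly f (- csqrt x)"
      by (simp add: mult.assoc)
  qed
  moreover have "g = h" if "?P g" "?P h" for g h
  proof -
    have "poly g = poly h" using that by (intro ext) simp
    then show ?thesis by (simp only: poly_eq_poly_eq_iff)
  qed
  ultimately have "\<exists>!g. ?P g" by blast
  from theI'[OF this] show ?thesis unfolding graeffe_def by blast
qed

text \<open>The \<open>j\<close>-th entry of the output after \<open>k\<close> steps is the pair of the renormalized
  log-modulus and the argument of the \<open>j\<close>-th coefficient of the \<open>k\<close>-th Graeffe iterate.\<close>

definition renormalized_graeffe :: "nat \<Rightarrow> complex poly \<Rightarrow> nat \<Rightarrow> real \<times> real" where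
  "renormalized_graeffe k f j =
     (let a = coeff ((graeffe ^^ k) f) j in (ln (cmod a) / 2 ^ k, Arg a))"

definition graeffe_log_root :: "nat \<Rightarrow> complex poly \<Rightarrow> nat \<Rightarrow> real" where
  "graeffe_log_root k f j =
     fst (renormalized_graeffe k f j) - fst (renormalized_graeffe k f (Suc j))"

definition roots_decreasing :: "complex poly \<Rightarrow> (nat \<Rightarrow> complex) \<Rightarrow> bool" where
  "roots_decreasing f \<zeta> \<longleftrightarrow>
     image_mset \<zeta> (mset_set {1..degree f}) = proots f \<and>
     antimono_on {1..degree f} (\<lambda>i. cmod (\<zeta> i))"

lemma roots_decreasing_exists: "\<exists>\<zeta>. roots_decreasing f \<zeta>"
proof -
  obtain xs where xs: "mset xs = proots f" using ex_mset by blast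
  define zs where "zs = sort_key (\<lambda>z. - cmod z) xs"
  have mset: "mset zs = proots f" by (simp add: zs_def xs)
  then have len: "length zs = degree f"
    by (metis size_mset size_proots_complex)
  have srt: "sorted (map (\<lambda>z. - cmod z) zs)" by (simp add: zs_def)
  have "image_mset (\<lambda>i. zs ! (i - 1)) (mset_set {1..degree f}) = mset zs"
  proof -
    have "mset_set {1..degree f} = image_mset Suc (mset_set {0..<degree f})"
      by (subst image_mset_mset_set) (auto simp: image_Suc_atLeastLessThan atLeastLessThanSuc_atLeastAtMost)
    then have "image_mset (\<lambda>i. zs ! (i - 1)) (mset_set {1..degree f}) =
        image_mset ((!) zs) (mset_set {0..<length zs})"
      by (simp add: multiset.map_comp comp_def len)
    also have "\<dots> = mset (map ((!) zs) [0..<length zs])"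
      by (simp only: mset_map mset_upt)
    finally show ?thesis by (simp only: map_nth)
  qed
  moreover have "antimono_on {1..degree f} (\<lambda>i. cmod (zs ! (i - 1)))"
  proof (rule monotone_onI)
    fix i j assume ij: "i \<in> {1..degree f}" "j \<in> {1..degree f}" "i \<le> j"
    then have "i - 1 \<le> j - 1" "j - 1 < length zs" using len by auto
    then show "cmod (zs ! (j - 1)) \<le> cmod (zs ! (i - 1))"
      using sorted_nth_mono[OF srt, of "i - 1" "j - 1"] by simp
  qed
  ultimately have "roots_decreasing f (\<lambda>i. zs ! (i - 1))"
    by (simp add: roots_decreasing_def mset)
  then show ?thesis by blast
qed

definition approximates_rel :: "real \<Rightarrow> real \<Rightarrow> real \<Rightarrow> bool" where
  "approximates_rel b y x \<longleftrightarrow> \<bar>y - x\<bar> \<le> 2 powr (- b) * \<bar>x\<bar>"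

text \<open>Since \<open>ln 0 = 0\<close> in HOL, the coefficients of the iterate are required to be nonzero, so that
  all the logarithms produced are genuine. For \<open>j = 0\<close> this also forces all roots to be nonzero.\<close>

definition graeffe_succeeds :: "nat \<Rightarrow> real \<Rightarrow> complex poly \<Rightarrow> bool" where
  "graeffe_succeeds k b f \<longleftrightarrow>
     (\<forall>j\<le>degree f. coeff ((graeffe ^^ k) f) j \<noteq> 0) \<and>
     (\<forall>\<zeta>. roots_decreasing f \<zeta> \<longrightarrow>
        (\<forall>j<degree f. approximates_rel b (graeffe_log_root k f j) (ln (cmod (\<zeta> (degree f - j))))))"


section \<open>Admissible distributions\<close>

text \<open>Nonzero coefficient vectors in \<open>\<complex>\<^bsup>d+1\<^esup>\<close>, indexed by \<open>{..d}\<close>.\<close>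

definition coeff_vectors :: "nat \<Rightarrow> (nat \<Rightarrow> complex) set" where
  "coeff_vectors d = {v \<in> extensional {..d}. \<exists>i\<le>d. v i \<noteq> 0}"

definition coeff_space :: "nat \<Rightarrow> (nat \<Rightarrow> complex) measure" where
  "coeff_space d = restrict_space (\<Pi>\<^sub>M i\<in>{..d}. lborel) (coeff_vectors d)"

definition poly_of_coeffs :: "nat \<Rightarrow> (nat \<Rightarrow> complex) \<Rightarrow> complex poly" where
  "poly_of_coeffs d v = (\<Sum>i\<le>d. monom (v i) i)"

definition proj_class :: "nat \<Rightarrow> (nat \<Rightarrow> complex) \<Rightarrow> (nat \<Rightarrow> complex) set" where
  "proj_class d v = {\<lambda>i\<in>{..d}. c * v i | c. c \<noteq> 0}"

text \<open>The projectivization, with the quotient \<open>\<sigma>\<close>-algebra (which is its Borel \<open>\<sigma>\<close>-algebra).\<close>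

definition proj_space :: "nat \<Rightarrow> (nat \<Rightarrow> complex) set measure" where
  "proj_space d = sigma (proj_class d ` coeff_vectors d)
     {A. A \<subseteq> proj_class d ` coeff_vectors d \<and>
         proj_class d -` A \<inter> coeff_vectors d \<in> sets (coeff_space d)}"

definition projectivize :: "nat \<Rightarrow> (nat \<Rightarrow> complex) measure \<Rightarrow> (nat \<Rightarrow> complex) set measure" where
  "projectivize d M = distr M (proj_space d) (proj_class d)"

text \<open>The uniform probability on the projectivization: the direction of a uniformly distributed
  point of the unit ball.\<close>

definition unit_ball :: "nat \<Rightarrow> (nat \<Rightarrow> complex) set" where
  "unit_ball d = {v \<in> coeff_vectors d. (\<Sum>i\<le>d. (cmod (v i))\<^sup>2) \<le> 1}"

definition uniform_proj :: "nat \<Rightarrow> (nat \<Rightarrow> complex) set measure" where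
  "uniform_proj d = projectivize d (uniform_measure (coeff_space d) (unit_ball d))"

definition admissible :: "nat \<Rightarrow> (nat \<Rightarrow> complex) measure \<Rightarrow> bool" where
  "admissible d M \<longleftrightarrow>
     prob_space M \<and> sets M = sets (coeff_space d) \<and>
     absolutely_continuous (uniform_proj d) (projectivize d M) \<and>
     (\<exists>C::real. AE L in uniform_proj d. RN_deriv (uniform_proj d) (projectivize d M) L \<le> ennreal C)"

lemma space_coeff_space [simp]: "space (coeff_space d) = coeff_vectors d"
  by (auto simp: coeff_space_def coeff_vectors_def space_restrict_space space_PiM PiE_def)

lemma space_proj_space: "space (proj_space d) = proj_class d ` coeff_vectors d"
  unfolding proj_space_def by (rule space_measure_of) blast

lemma proj_class_measurable [measurable]:
  "proj_class d \<in> coeff_space d \<rightarrow>\<^sub>M proj_space d"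
  unfolding proj_space_def by (rule measurable_measure_of) auto

lemma unit_ball_measurable [measurable]: "unit_ball d \<in> sets (coeff_space d)"
proof -
  have "{v \<in> space (\<Pi>\<^sub>M i\<in>{..d}. lborel). (\<Sum>i\<le>d. (cmod (v i))\<^sup>2) \<le> 1}
      \<in> sets (\<Pi>\<^sub>M i\<in>{..d}. (lborel :: complex measure))"
    by measurable
  moreover have "unit_ball d = coeff_vectors d \<inter>
      {v \<in> space (\<Pi>\<^sub>M i\<in>{..d}. lborel). (\<Sum>i\<le>d. (cmod (v i))\<^sup>2) \<le> 1}"
    by (auto simp: unit_ball_def coeff_vectors_def space_PiM PiE_def)
  ultimately show ?thesis
    unfolding coeff_space_def sets_restrict_space by blast
qed

lemma coeff_vectors_measurable:
  "coeff_vectors d \<in> sets (\<Pi>\<^sub>M i\<in>{..d}. lborel)"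
proof -
  have "{v \<in> space (\<Pi>\<^sub>M i\<in>{..d}. lborel). \<exists>i\<in>{..d}. v i \<noteq> (0::complex)} \<in> sets (\<Pi>\<^sub>M i\<in>{..d}. lborel)"
    by measurable
  moreover have "{v \<in> space (\<Pi>\<^sub>M i\<in>{..d}. lborel). \<exists>i\<in>{..d}. v i \<noteq> (0::complex)} = coeff_vectors d"
    by (auto simp: coeff_vectors_def space_PiM PiE_def)
  ultimately show ?thesis by simp
qed

lemma prob_space_uniform_proj: "prob_space (uniform_proj d)"
proof -
  interpret product_sigma_finite "\<lambda>_::nat. lborel :: complex measure" by unfold_locales
  let ?L = "\<Pi>\<^sub>M i\<in>{..d}. (lborel :: complex measure)"
  have sub: "unit_ball d \<subseteq> coeff_vectors d" by (auto simp: unit_ball_def)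
  have em: "emeasure (coeff_space d) A = emeasure ?L A" if "A \<subseteq> coeff_vectors d" for A
    unfolding coeff_space_def using that coeff_vectors_measurable
    by (intro emeasure_restrict_space) (auto simp: Int_absorb2 sets.Int_space_eq2)
  have meas: "unit_ball d \<in> sets ?L"
    using unit_ball_measurable[of d] coeff_vectors_measurable[of d]
    by (auto simp: coeff_space_def sets_restrict_space_iff sets.Int_space_eq2)
  have "emeasure ?L (unit_ball d) \<le> emeasure ?L (\<Pi>\<^sub>E i\<in>{..d}. cball 0 1)"
  proof (rule emeasure_mono)
    show "unit_ball d \<subseteq> (\<Pi>\<^sub>E i\<in>{..d}. cball 0 1)"
    proof
      fix v assume v: "v \<in> unit_ball d"
      have "cmod (v i) \<le> 1" if "i \<le> d" for i
      proof -
        have "(cmod (v i))\<^sup>2 \<le> (\<Sum>i\<le>d. (cmod (v i))\<^sup>2)"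
          using that by (intro member_le_sum) auto
        also have "\<dots> \<le> 1" using v by (simp add: unit_ball_def)
        finally show ?thesis by (simp add: power_le_one_iff abs_square_le_1)
      qed
      then show "v \<in> (\<Pi>\<^sub>E i\<in>{..d}. cball 0 1)"
        using v by (auto simp: unit_ball_def coeff_vectors_def PiE_def)
    qed
  qed (auto intro!: sets_PiM_I_finite)
  also have "\<dots> = (\<Prod>i\<in>{..d}. emeasure lborel (cball (0::complex) 1))"
    by (rule emeasure_PiM) auto
  also have "\<dots> < \<infinity>"
    unfolding prod_constant emeasure_cball[OF zero_le_one] infinity_ennreal_def
    by (subst ennreal_power) auto
  finally have fin: "emeasure (coeff_space d) (unit_ball d) \<noteq> \<infinity>" by (simp add: em[OF sub])
  define r :: real where "r = 1 / (d + 1)"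
  have r: "r > 0" "r \<le> 1" by (auto simp: r_def)
  have "0 < (\<Prod>i\<in>{..d}. emeasure lborel (ball (0::complex) r - {0}))"
  proof -
    have "emeasure lborel (ball (0::complex) r - {0}) = emeasure lborel (ball (0::complex) r)"
      by (rule emeasure_Diff_null_set) (auto simp: finite_imp_null_set_lborel)
    also have "\<dots> > 0"
      unfolding emeasure_ball[OF less_imp_le[OF r(1)]]
      using r(1) by (intro ennreal_less_zero_iff[THEN iffD2] mult_pos_pos unit_ball_vol_pos zero_less_power) auto
    finally have "emeasure lborel (ball (0::complex) r - {0}) \<noteq> 0" by (metis less_irrefl)
    then have "(\<Prod>i\<in>{..d}. emeasure lborel (ball (0::complex) r - {0})) \<noteq> 0"
      unfolding prod_constant by (rule power_not_zero)
    then show ?thesis by (simp only: zero_less_iff_neq_zero not_False_eq_True)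
  qed
  also have "\<dots> = emeasure ?L (\<Pi>\<^sub>E i\<in>{..d}. ball 0 r - {0})"
    by (rule emeasure_PiM[symmetric]) auto
  also have "\<dots> \<le> emeasure ?L (unit_ball d)"
  proof (rule emeasure_mono[OF _ meas])
    show "(\<Pi>\<^sub>E i\<in>{..d}. ball 0 r - {0}) \<subseteq> unit_ball d"
    proof
      fix v assume v: "v \<in> (\<Pi>\<^sub>E i\<in>{..d}. ball (0::complex) r - {0})"
      have "(cmod (v i))\<^sup>2 \<le> r" if "i \<le> d" for i
      proof -
        have "cmod (v i) \<le> r" using v that by (fastforce simp: PiE_def Pi_def)
        then have "(cmod (v i))\<^sup>2 \<le> r * 1"
          unfolding power2_eq_square using r by (intro mult_mono) auto
        then show ?thesis by simp
      qed
      then have "(\<Sum>i\<le>d. (cmod (v i))\<^sup>2) \<le> (\<Sum>i\<le>d. r)" by (intro sum_mono) auto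
      also have "\<dots> = 1" by (simp add: r_def field_simps)
      finally show "v \<in> unit_ball d"
        using v by (auto simp: unit_ball_def coeff_vectors_def PiE_def Pi_def)
    qed
  qed
  finally have pos: "emeasure (coeff_space d) (unit_ball d) \<noteq> 0" by (simp add: em[OF sub])
  interpret U: prob_space "uniform_measure (coeff_space d) (unit_ball d)"
    by (rule prob_space_uniform_measure[OF pos fin])
  show ?thesis
    unfolding uniform_proj_def projectivize_def
    by (rule U.prob_space_distr) simp
qed

end

theory Submission
  imports Defs
begin

text \<open>If the root moduli are separated by ratios of at least \<open>q > 1\<close>, then after \<open>k\<close> steps every
  coefficient is its leading product of roots up to a relative error of order \<open>2^d / q^(2^k)\<close>, so
  the iteration succeeds as soon as \<open>2^k log q\<close> exceeds \<open>b\<close> plus \<open>O(log (1/\<eta>))\<close>, where \<open>\<eta>\<close> is the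
  distance of the moduli from \<open>1\<close>.  With \<open>q = 1 + 1/(2N)\<close> it remains to see that the exceptional
  polynomials have measure \<open>O(1/N)\<close>.  Two roots in the disc of radius \<open>2\<close> with moduli differing by
  at most \<open>1/N\<close> lie near one of \<open>O(N^3)\<close> pairs of net points, and each pair forces two independent
  linear conditions on the coefficients, of measure \<open>O(1/N^4)\<close>; large roots are handled by reversing
  the polynomial, and roots near the unit circle in the same way with \<open>O(N)\<close> net points and one
  condition of measure \<open>O(1/N^2)\<close>.  Choosing \<open>N\<close> of order \<open>1/\<delta>\<close> gives \<open>c\<^sub>2 = 1\<close> and \<open>c\<^sub>3 = 2\<close>.\<close>

section \<open>Graeffe iterates and their coefficients\<close>

text \<open>Relative precision for ln |\<zeta>| is lost where this logarithm vanishes, so roots near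
  the unit circle are exceptional even when well separated. The radius 2 makes the discs for the
  roots and for their inverses overlap: a pair of roots that escapes both has one modulus above 2
  and the other below 1/2, hence a ratio above 4. Only the moduli of a bad pair nearly agree while
  the arguments are free; this one real condition is what saves a factor N in the number of net
  pairs. The conditions p(z) = 0 and p(w) = 0 degenerate as w tends to z. Replacing the second by
  the divided difference keeps the two linear forms triangular with unit diagonal, so the volume
  bound is uniform in the pair. Admissibility only speaks of the projectivization, which suffices
  because success is invariant under scaling. The value 2 for c3 arises because N, of order 1 /
  \<delta>, enters twice: raising 1 + 1/(2N) to the power 2N gains a factor 2, and about N such
  factors are spent on the distance of the moduli from 1.\<close>

lemma poly_graeffe_square:
  "poly (graeffe f) (x\<^sup>2) = (- 1) ^ degree f * poly f x * poly f (- x)"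
proof -
  \<comment> \<open>The branch of the square root is irrelevant, since f(x) f(-x) is symmetric under
    x -> -x.\<close>
  have "csqrt (x\<^sup>2) = x \<or> csqrt (x\<^sup>2) = - x"
    by (metis power2_csqrt power2_eq_iff)
  then show ?thesis
    by (auto simp: poly_graeffe)
qed

lemma graeffe_eqI:
  assumes "\<And>x. poly g (x\<^sup>2) = (- 1) ^ degree f * poly f x * poly f (- x)"
  shows "graeffe f = g"
proof -
  have "poly (graeffe f) y = poly g y" for y
    using assms[of "csqrt y"] poly_graeffe_square[of f "csqrt y"] by simp
  then show ?thesis
    by (simp add: poly_eq_poly_eq_iff[symmetric] fun_eq_iff)
qed

lemma graeffe_smult:
  assumes "c \<noteq> 0"
  shows "graeffe (smult c f) = smult (c\<^sup>2) (graeffe f)"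
  by (rule graeffe_eqI) (use assms in \<open>simp add: poly_graeffe_square, simp add: power2_eq_square\<close>)

lemma degree_prod_linear: "degree (\<Prod>i\<in>I. [:- z i, 1:] :: complex poly) = card I"
  by (simp add: degree_prod_eq_sum_degree)

lemma graeffe_prod_linear:
  "graeffe (\<Prod>i\<in>I. [:- z i, 1:]) = (\<Prod>i\<in>I. [:- ((z i)\<^sup>2), 1:])"
proof (rule graeffe_eqI)
  fix x :: complex
  \<comment> \<open>One sign goes to each root: -(x - z)(-x - z) = x^2 - z^2.\<close>
  have "(-1) ^ card I * (\<Prod>i\<in>I. x - z i) * (\<Prod>i\<in>I. - x - z i) =
      (\<Prod>i\<in>I. - 1 * (x - z i) * (- x - z i))"
    unfolding prod.distrib prod_constant ..
  also have "\<dots> = (\<Prod>i\<in>I. x\<^sup>2 - (z i)\<^sup>2)"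
    by (intro prod.cong) (auto simp: power2_eq_square algebra_simps)
  finally show "poly (\<Prod>i\<in>I. [:- ((z i)\<^sup>2), 1:]) (x\<^sup>2) =
      (- 1) ^ degree (\<Prod>i\<in>I. [:- z i, 1:]) * poly (\<Prod>i\<in>I. [:- z i, 1:]) x *
      poly (\<Prod>i\<in>I. [:- z i, 1:]) (- x)"
    by (simp add: degree_prod_linear poly_prod minus_diff_commute)
qed

lemma graeffe_iterate_smult:
  assumes "c \<noteq> 0"
  shows "(graeffe ^^ k) (smult c f) = smult (c ^ 2 ^ k) ((graeffe ^^ k) f)"
proof (induction k)
  case (Suc k)
  have "(c ^ 2 ^ k)\<^sup>2 = c ^ 2 ^ Suc k"
    by (simp add: power_mult[symmetric] mult.commute)
  then show ?case using Suc assms by (simp add: graeffe_smult)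
qed simp

lemma graeffe_iterate_prod_linear:
  "(graeffe ^^ k) (\<Prod>i\<in>I. [:- z i, 1:]) = (\<Prod>i\<in>I. [:- (z i ^ 2 ^ k), 1:])"
proof (induction k)
  case (Suc k)
  have "(z i ^ 2 ^ k)\<^sup>2 = z i ^ 2 ^ Suc k" for i
    by (simp add: power_mult[symmetric] mult.commute)
  then show ?case using Suc by (simp add: graeffe_prod_linear)
qed simp

lemma roots_decreasing_factor:
  assumes "roots_decreasing f \<zeta>"
  shows "f = smult (lead_coeff f) (\<Prod>i\<in>{1..degree f}. [:- \<zeta> i, 1:])"
proof -
  have "proots f = image_mset \<zeta> (mset_set {1..degree f})"
    using assms by (simp add: roots_decreasing_def)
  then have "(\<Prod>x\<in>#proots f. [:- x, 1:]) = (\<Prod>i\<in>{1..degree f}. [:- \<zeta> i, 1:])"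
    by (simp only: prod_unfold_prod_mset multiset.map_comp comp_def)
  then show ?thesis by (metis complex_poly_decompose_multiset)
qed

lemma roots_decreasing_smult:
  assumes "c \<noteq> 0"
  shows "roots_decreasing (smult c f) \<zeta> \<longleftrightarrow> roots_decreasing f \<zeta>"
  using assms by (simp add: roots_decreasing_def)

lemma degree_graeffe_iterate:
  assumes "f \<noteq> 0"
  shows "degree ((graeffe ^^ k) f) = degree f"
proof -
  obtain \<zeta> where \<zeta>: "roots_decreasing f \<zeta>" using roots_decreasing_exists by blast
  define c where "c = lead_coeff f"
  define d where "d = degree f"
  have "c \<noteq> 0" using assms by (simp add: c_def)
  then show ?thesis
    unfolding d_def[symmetric] roots_decreasing_factor[OF \<zeta>, folded c_def d_def]
    by (simp add: graeffe_iterate_smult graeffe_iterate_prod_linear degree_prod_linear)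
qed

section \<open>Coefficients of the iterates as polynomial expressions in the input\<close>

lemma coeff_even_of_square_substitution:
  fixes p q :: "complex poly"
  assumes "\<And>x. poly p x = poly q (x\<^sup>2)"
  shows "coeff p (2 * j) = coeff q j"
proof -
  have "p = pcompose q [:0, 0, 1:]"
    unfolding poly_eq_poly_eq_iff[symmetric] fun_eq_iff
    by (simp add: assms poly_pcompose power2_eq_square)
  moreover have "coeff (pcompose q [:0, 0, 1:]) (2 * j) = coeff q j"
  proof (induction q arbitrary: j)
    case (pCons a q)
    then show ?case
      by (cases j) (auto simp: pcompose_pCons)
  qed simp
  ultimately show ?thesis by simp
qed

lemma coeff_graeffe:
  "coeff (graeffe f) j =
     (- 1) ^ degree f * (\<Sum>i\<le>2 * j. (- 1) ^ i * coeff f i * coeff f (2 * j - i))"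
proof -
  let ?p = "smult ((- 1) ^ degree f) (pcompose f (monom (-1) 1) * f)"
  have "poly ?p x = poly (graeffe f) (x\<^sup>2)" for x
    by (simp add: poly_graeffe_square poly_pcompose poly_monom)
  from coeff_even_of_square_substitution[OF this, of j]
  have "coeff (graeffe f) j = coeff ?p (2 * j)" by simp
  also have "\<dots> = (- 1) ^ degree f * (\<Sum>i\<le>2 * j. (- 1) ^ i * coeff f i * coeff f (2 * j - i))"
    by (simp add: coeff_mult mult.assoc)
  finally show ?thesis .
qed

text \<open>The degree d is a fixed parameter here, so that every entry is visibly a polynomial in
  the coefficient vector. The sign in \<open>graeffe\<close> depends on the actual degree instead,
  which is why the two agree only when \<open>v d\<close> is nonzero.\<close>

fun graeffe_coeff :: "nat \<Rightarrow> (nat \<Rightarrow> complex) \<Rightarrow> nat \<Rightarrow> nat \<Rightarrow> complex" where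
  "graeffe_coeff d a 0 j = (if j \<le> d then a j else 0)"
| "graeffe_coeff d a (Suc k) j =
     (- 1) ^ d * (\<Sum>i\<le>2 * j. (- 1) ^ i * graeffe_coeff d a k i * graeffe_coeff d a k (2 * j - i))"

lemma coeff_poly_of_coeffs: "coeff (poly_of_coeffs d v) j = (if j \<le> d then v j else 0)"
  by (simp add: poly_of_coeffs_def coeff_sum)

lemma degree_poly_of_coeffs_eq_iff:
  assumes "d \<ge> 1"
  shows "degree (poly_of_coeffs d v) = d \<longleftrightarrow> v d \<noteq> 0"
proof
  assume "degree (poly_of_coeffs d v) = d"
  then show "v d \<noteq> 0"
    by (metis assms coeff_poly_of_coeffs degree_0 leading_coeff_0_iff not_one_le_zero order_refl)
next
  assume "v d \<noteq> 0"
  then have "d \<le> degree (poly_of_coeffs d v)"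
    by (intro le_degree) (simp add: coeff_poly_of_coeffs)
  moreover have "degree (poly_of_coeffs d v) \<le> d"
    by (rule degree_le) (simp add: coeff_poly_of_coeffs)
  ultimately show "degree (poly_of_coeffs d v) = d" by simp
qed

lemma coeff_graeffe_iterate:
  assumes "d \<ge> 1" "v d \<noteq> 0"
  shows "coeff ((graeffe ^^ k) (poly_of_coeffs d v)) j = graeffe_coeff d v k j"
proof -
  have d: "degree (poly_of_coeffs d v) = d" using assms degree_poly_of_coeffs_eq_iff by simp
  with assms have nz: "poly_of_coeffs d v \<noteq> 0" by auto
  show ?thesis
    by (induction k arbitrary: j)
       (simp_all add: coeff_poly_of_coeffs coeff_graeffe degree_graeffe_iterate[OF nz] d)
qed

text \<open>Scaling by c adds the same term \<open>ln (cmod c ^ 2 ^ k)\<close> to every logarithm,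
  and it cancels in the differences. Success is therefore a property of the projective class.
  Nonvanishing of the coefficients is what makes the logarithms additive, given ln 0 = 0.\<close>

lemma graeffe_succeeds_smult:
  assumes "c \<noteq> 0" "f \<noteq> 0"
  shows "graeffe_succeeds k b (smult c f) \<longleftrightarrow> graeffe_succeeds k b f"
proof -
  have "graeffe_log_root k (smult c f) j = graeffe_log_root k f j"
    if nz: "\<forall>j\<le>degree f. coeff ((graeffe ^^ k) f) j \<noteq> 0" and j: "j < degree f" for j
  proof -
    have *: "ln (cmod (coeff ((graeffe ^^ k) (smult c f)) i)) =
        ln (cmod c ^ 2 ^ k) + ln (cmod (coeff ((graeffe ^^ k) f) i))" if "i \<le> degree f" for i
      using nz that assms(1)
      by (simp add: graeffe_iterate_smult norm_mult norm_power ln_mult)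
    show ?thesis
      using *[of j] *[of "Suc j"] j
      by (simp add: graeffe_log_root_def renormalized_graeffe_def Let_def add_divide_distrib)
  qed
  then show ?thesis
    using assms
    by (auto simp: graeffe_succeeds_def roots_decreasing_smult graeffe_iterate_smult)
qed

section \<open>Separated roots\<close>

text \<open>The smallest root is split off in the induction: it multiplies a coefficient that is already
  dominated by its leading monomial.\<close>

lemma coeff_prod_linear_separated:
  fixes z :: "nat \<Rightarrow> complex"
  assumes "R \<ge> 1" "\<And>i j. 1 \<le> i \<Longrightarrow> i < j \<Longrightarrow> j \<le> d \<Longrightarrow> R * cmod (z j) \<le> cmod (z i)"
    and "j \<le> d"
  shows "cmod (coeff (\<Prod>i\<in>{1..d}. [:- z i, 1:]) j - (- 1) ^ (d - j) * (\<Prod>i\<in>{1..d - j}. z i))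
    \<le> (2 ^ d - 1) / R * (\<Prod>i\<in>{1..d - j}. cmod (z i))"
  using assms(2,3)
proof (induction d arbitrary: j)
  case (Suc d)
  define g where "g = (\<Prod>i\<in>{1..d}. [:- z i, 1:])"
  define P where "P s = (\<Prod>i\<in>{1..s}. z i)" for s
  define E where "E m = (2 ^ m - 1) / R" for m
  have nP: "(\<Prod>i\<in>{1..s}. cmod (z i)) = cmod (P s)" for s
    by (simp add: P_def prod_norm)
  have IH: "cmod (coeff g j - (- 1) ^ (d - j) * P (d - j)) \<le> E d * cmod (P (d - j))"
    if "j \<le> d" for j
    using Suc.IH[of j] Suc.prems(1) that unfolding nP g_def P_def E_def by simp
  have E0: "E m \<ge> 0" for m using assms(1) by (simp add: E_def)
  have Emono: "E d \<le> E (Suc d)" using assms(1) by (simp add: E_def divide_right_mono)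
  \<comment> \<open>Here \<open>E d\<close> is the error inherited from the dominant term and (1 +
    \<open>E d\<close>) / R the size of the neighbouring one. Since R \<ge> 1, 1 +
    \<open>E d\<close> is at most 2^d, and (2^d - 1)/R + 2^d/R is exactly the next bound.\<close>
  have E2: "E d + (1 + E d) / R \<le> E (Suc d)"
  proof -
    have "(2 ^ d - 1) * 1 \<le> (2 ^ d - 1) * R" using assms(1) by (intro mult_left_mono) auto
    then have "E d \<le> 2 ^ d - 1" using assms(1) by (simp add: E_def divide_le_eq)
    then have "(1 + E d) / R \<le> 2 ^ d / R" using assms(1) by (intro divide_right_mono) auto
    also have "E d + 2 ^ d / R = E (Suc d)"
      by (simp add: E_def add_divide_distrib[symmetric])
    finally show ?thesis by simp
  qed
  have g': "(\<Prod>i\<in>{1..Suc d}. [:- z i, 1:]) = pCons 0 g + smult (- z (Suc d)) g"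
    by (simp add: g_def mult.commute)
  have PS: "P (Suc s) = P s * z (Suc s)" for s by (simp add: P_def)
  have "cmod (coeff (pCons 0 g + smult (- z (Suc d)) g) j - (- 1) ^ (Suc d - j) * P (Suc d - j))
    \<le> E (Suc d) * cmod (P (Suc d - j))"
  proof (cases j)
    case 0
    have "coeff (pCons 0 g + smult (- z (Suc d)) g) j - (- 1) ^ (Suc d - j) * P (Suc d - j) =
        - z (Suc d) * (coeff g 0 - (- 1) ^ (d - 0) * P (d - 0))"
      by (simp add: 0 PS algebra_simps)
    also have "cmod \<dots> \<le> cmod (z (Suc d)) * (E d * cmod (P (d - 0)))"
      unfolding norm_mult norm_minus_cancel by (intro mult_left_mono IH) auto
    also have "\<dots> = E d * cmod (P (Suc d))" by (simp add: PS norm_mult mult_ac)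
    also have "\<dots> \<le> E (Suc d) * cmod (P (Suc d))" by (intro mult_right_mono Emono) auto
    finally show ?thesis by (simp add: 0)
  next
    case (Suc m)
    then have m: "m \<le> d" using Suc.prems by simp
    have main: "cmod (coeff g m - (- 1) ^ (d - m) * P (d - m)) \<le> E d * cmod (P (d - m))"
      by (rule IH[OF m])
    \<comment> \<open>The next coefficient of g carries a product with one root fewer. The
      separation bounds |z (d+1)| by |z (s+1)| / R, which supplies the missing factor together with
      the gain 1/R.\<close>
    have rest: "cmod (z (Suc d) * coeff g (Suc m)) \<le> (1 + E d) / R * cmod (P (d - m))"
    proof (cases "Suc m \<le> d")
      case True
      define s where "s = d - Suc m"
      have s: "d - m = Suc s" using True by (simp add: s_def)
      have "cmod (coeff g (Suc m)) \<le> cmod (coeff g (Suc m) - (- 1) ^ s * P s) + cmod ((- 1) ^ s * P s)"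
        by (metis diff_add_cancel norm_triangle_ineq)
      also have "\<dots> \<le> E d * cmod (P s) + cmod (P s)"
        using IH[OF True] by (simp add: s_def norm_mult norm_power)
      finally have c: "cmod (coeff g (Suc m)) \<le> (1 + E d) * cmod (P s)" by (simp add: algebra_simps)
      have zz: "cmod (z (Suc d)) \<le> cmod (z (Suc s)) / R"
        using Suc.prems(1)[of "Suc s" "Suc d"] True assms(1) by (simp add: s_def field_simps)
      have "cmod (z (Suc d) * coeff g (Suc m)) \<le> cmod (z (Suc s)) / R * ((1 + E d) * cmod (P s))"
        unfolding norm_mult using assms(1) by (intro mult_mono zz c) auto
      then show ?thesis by (simp add: s PS norm_mult field_simps)
    next
      case False
      have "degree g = d" by (simp add: g_def degree_prod_linear)
      with False have "coeff g (Suc m) = 0" by (intro coeff_eq_0) simp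
      then show ?thesis using E0[of d] assms(1) by simp
    qed
    have "cmod (coeff (pCons 0 g + smult (- z (Suc d)) g) j - (- 1) ^ (Suc d - j) * P (Suc d - j))
        = cmod ((coeff g m - (- 1) ^ (d - m) * P (d - m)) - z (Suc d) * coeff g (Suc m))"
      by (simp add: Suc algebra_simps)
    also have "\<dots> \<le> E d * cmod (P (d - m)) + (1 + E d) / R * cmod (P (d - m))"
      by (rule order_trans[OF norm_triangle_ineq4 add_mono[OF main rest]])
    also have "\<dots> = (E d + (1 + E d) / R) * cmod (P (d - m))" by (simp add: algebra_simps)
    also have "\<dots> \<le> E (Suc d) * cmod (P (d - m))" by (intro mult_right_mono E2) auto
    finally show ?thesis by (simp add: Suc)
  qed
  then show ?case unfolding g' nP P_def[symmetric] E_def[symmetric] .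
qed simp

text \<open>For |u| \<le> 1/2 the remainder 2 u^2 of ln (1 + u) is itself at most |u|; this doubles
  the first-order bound.\<close>

lemma abs_ln_perturbation:
  fixes x p t :: real
  assumes "\<bar>x - p\<bar> \<le> t * p" "p > 0" "t \<le> 1 / 2"
  shows "x > 0" "\<bar>ln x - ln p\<bar> \<le> 2 * t"
proof -
  define u where "u = x / p - 1"
  have "\<bar>u\<bar> = \<bar>x - p\<bar> / p" using assms(2) by (simp add: u_def abs_if field_simps)
  also have "\<dots> \<le> t" using assms by (simp add: divide_le_eq)
  finally have u: "\<bar>u\<bar> \<le> t" .
  have x: "x = p * (1 + u)" using assms(2) by (simp add: u_def)
  show "x > 0" unfolding x using u assms by (intro mult_pos_pos) auto
  have "\<bar>ln (1 + u) - u\<bar> \<le> 2 * u\<^sup>2"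
    using u assms by (intro abs_ln_one_plus_x_minus_x_bound) auto
  also have "\<dots> = 2 * \<bar>u\<bar> * \<bar>u\<bar>" by (simp add: power2_eq_square)
  also have "\<dots> \<le> 1 * \<bar>u\<bar>" using u assms by (intro mult_right_mono) auto
  finally have "\<bar>ln (1 + u)\<bar> \<le> 2 * t" using u by linarith
  moreover have "ln x = ln p + ln (1 + u)" unfolding x using assms u by (subst ln_mult) auto
  ultimately show "\<bar>ln x - ln p\<bar> \<le> 2 * t" by simp
qed

text \<open>In the difference of two consecutive logarithms the leading coefficient and the common
  product of roots cancel, and 2^k ln |\<zeta> (d - j)| remains. Each logarithm contributes an error
  2t with t = 2^d / q^(2^k), and the hypothesis \<open>big\<close> says t \<le> 1/2.\<close>

lemma graeffe_log_root_error:
  assumes rd: "roots_decreasing f \<zeta>" and nz: "\<And>i. 1 \<le> i \<Longrightarrow> i \<le> degree f \<Longrightarrow> \<zeta> i \<noteq> 0"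
    and f: "f \<noteq> 0"
    and sep: "\<And>i j. 1 \<le> i \<Longrightarrow> i < j \<Longrightarrow> j \<le> degree f \<Longrightarrow> q * cmod (\<zeta> j) \<le> cmod (\<zeta> i)"
    and q: "q \<ge> 1" and big: "q ^ 2 ^ k \<ge> 2 * 2 ^ degree f"
  shows "j \<le> degree f \<Longrightarrow> coeff ((graeffe ^^ k) f) j \<noteq> 0"
    and "j < degree f \<Longrightarrow>
      \<bar>graeffe_log_root k f j - ln (cmod (\<zeta> (degree f - j)))\<bar> \<le> 4 * 2 ^ degree f / q ^ 2 ^ k / 2 ^ k"
proof -
  define d where "d = degree f"
  define c where "c = lead_coeff f"
  define z where "z i = \<zeta> i ^ 2 ^ k" for i
  define t where "t = 2 ^ d / q ^ 2 ^ k"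
  define P where "P s = (\<Prod>i\<in>{1..s}. cmod (z i))" for s
  have c: "c \<noteq> 0" using f by (simp add: c_def)
  have R: "q ^ 2 ^ k \<ge> 1" using q by (rule one_le_power)
  have "f = smult c (\<Prod>i\<in>{1..d}. [:- \<zeta> i, 1:])"
    using roots_decreasing_factor[OF rd] by (simp add: c_def d_def)
  then have it: "(graeffe ^^ k) f = smult (c ^ 2 ^ k) (\<Prod>i\<in>{1..d}. [:- z i, 1:])"
    using graeffe_iterate_smult[OF c, of k] graeffe_iterate_prod_linear[of k \<zeta> "{1..d}"]
    by (metis (no_types, lifting) prod.cong z_def)
  have t: "t \<le> 1 / 2" using big R by (simp add: t_def d_def field_simps)
  have P: "P s > 0" if "s \<le> d" for s
    unfolding P_def z_def using nz that by (intro prod_pos) (auto simp: d_def)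
  have co: "coeff ((graeffe ^^ k) f) j \<noteq> 0 \<and>
      \<bar>ln (cmod (coeff ((graeffe ^^ k) f) j)) - (2 ^ k * ln (cmod c) + ln (P (d - j)))\<bar> \<le> 2 * t"
    if j: "j \<le> d" for j
  proof -
    define a where "a = coeff (\<Prod>i\<in>{1..d}. [:- z i, 1:]) j"
    have "cmod (a - (- 1) ^ (d - j) * (\<Prod>i\<in>{1..d - j}. z i))
        \<le> (2 ^ d - 1) / q ^ 2 ^ k * (\<Prod>i\<in>{1..d - j}. cmod (z i))"
      unfolding a_def
    proof (rule coeff_prod_linear_separated[OF R _ j])
      fix i j assume "1 \<le> i" "i < j" "j \<le> d"
      then have "(q * cmod (\<zeta> j)) ^ 2 ^ k \<le> cmod (\<zeta> i) ^ 2 ^ k"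
        using q by (intro power_mono sep) (auto simp: d_def)
      then show "q ^ 2 ^ k * cmod (z j) \<le> cmod (z i)"
        by (simp add: z_def norm_power power_mult_distrib)
    qed
    also have "\<dots> \<le> t * P (d - j)"
      unfolding t_def P_def using R by (intro mult_right_mono divide_right_mono prod_nonneg) auto
    finally have "cmod (a - (- 1) ^ (d - j) * (\<Prod>i\<in>{1..d - j}. z i)) \<le> t * P (d - j)" .
    moreover have "cmod ((- 1) ^ (d - j) * (\<Prod>i\<in>{1..d - j}. z i)) = P (d - j)"
      by (simp add: norm_mult norm_power P_def prod_norm)
    ultimately have "\<bar>cmod a - P (d - j)\<bar> \<le> t * P (d - j)"
      by (metis norm_triangle_ineq3 order_trans)
    from abs_ln_perturbation[OF this P t] have "cmod a > 0" "\<bar>ln (cmod a) - ln (P (d - j))\<bar> \<le> 2 * t"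
      by auto
    then show ?thesis
      using c unfolding it coeff_smult a_def[symmetric]
      by (simp add: norm_mult norm_power ln_mult ln_realpow)
  qed
  show "coeff ((graeffe ^^ k) f) j \<noteq> 0" if "j \<le> degree f"
    using co[of j] that by (simp add: d_def)
  assume "j < degree f"
  then have j: "j < d" by (simp add: d_def)
  define s where "s = d - Suc j"
  have s: "d - j = Suc s" using j by (simp add: s_def)
  have nz': "cmod (\<zeta> (Suc s)) > 0"
    using nz[of "Suc s"] j by (simp add: s_def d_def)
  have "P s > 0" using P[of s] by (simp add: s_def)
  then have "ln (P (Suc s)) = ln (P s) + ln (cmod (z (Suc s)))"
    using ln_mult_pos[of "P s" "cmod (z (Suc s))"] nz' by (simp add: P_def z_def)
  also have "ln (cmod (z (Suc s))) = 2 ^ k * ln (cmod (\<zeta> (Suc s)))"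
    using ln_realpow[of "cmod (\<zeta> (Suc s))" "2 ^ k"] unfolding z_def norm_power by simp
  finally have P1: "ln (P (Suc s)) = ln (P s) + 2 ^ k * ln (cmod (\<zeta> (Suc s)))" .
  define A where "A i = ln (cmod (coeff ((graeffe ^^ k) f) i))" for i
  have "\<bar>A j - (2 ^ k * ln (cmod c) + ln (P (Suc s)))\<bar> \<le> 2 * t"
    using co[of j] j by (simp add: s A_def)
  moreover have "\<bar>A (Suc j) - (2 ^ k * ln (cmod c) + ln (P s))\<bar> \<le> 2 * t"
    using co[of "Suc j"] j by (simp add: s_def A_def)
  ultimately have "\<bar>A j - A (Suc j) - 2 ^ k * ln (cmod (\<zeta> (Suc s)))\<bar> \<le> 4 * t"
    using P1 by linarith
  then have "\<bar>A j - A (Suc j) - 2 ^ k * ln (cmod (\<zeta> (Suc s)))\<bar> / 2 ^ k \<le> 4 * t / 2 ^ k"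
    by (intro divide_right_mono) auto
  also have "\<bar>A j - A (Suc j) - 2 ^ k * ln (cmod (\<zeta> (Suc s)))\<bar> / 2 ^ k =
      \<bar>(A j - A (Suc j) - 2 ^ k * ln (cmod (\<zeta> (Suc s)))) / 2 ^ k\<bar>"
    by simp
  also have "(A j - A (Suc j) - 2 ^ k * ln (cmod (\<zeta> (Suc s)))) / 2 ^ k =
      graeffe_log_root k f j - ln (cmod (\<zeta> (degree f - j)))"
    by (simp add: graeffe_log_root_def renormalized_graeffe_def Let_def A_def d_def[symmetric] s
        diff_divide_distrib)
  finally show "\<bar>graeffe_log_root k f j - ln (cmod (\<zeta> (degree f - j)))\<bar>
      \<le> 4 * 2 ^ degree f / q ^ 2 ^ k / 2 ^ k"
    by (simp add: t_def d_def)
qed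

section \<open>Measurability of the root moduli\<close>

text \<open>Read from the smallest, the moduli form the sorted list of a multiset determined by f;
  only the order among roots of equal modulus is free.\<close>

lemma roots_decreasing_moduli_unique:
  assumes "roots_decreasing f \<zeta>" "roots_decreasing f \<xi>" "i \<in> {1..degree f}"
  shows "cmod (\<zeta> i) = cmod (\<xi> i)"
proof -
  define L where "L \<eta> = map (\<lambda>i. cmod (\<eta> i)) (rev [1..<Suc (degree f)])" for \<eta> :: "nat \<Rightarrow> complex"
  have mset: "mset (L \<eta>) = image_mset cmod (proots f)" if "roots_decreasing f \<eta>" for \<eta>
  proof -
    have "proots f = image_mset \<eta> (mset_set {1..degree f})"
      using that by (simp add: roots_decreasing_def)
    moreover have "{1..degree f} = {1..<Suc (degree f)}" by auto
    ultimately show ?thesis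
      by (simp only: L_def mset_map mset_rev mset_upt multiset.map_comp comp_def)
  qed
  have sorted: "sorted (L \<eta>)" if "roots_decreasing f \<eta>" for \<eta>
  proof -
    have am: "antimono_on {1..degree f} (\<lambda>i. cmod (\<eta> i))"
      using that by (simp add: roots_decreasing_def)
    show ?thesis
      unfolding L_def sorted_map sorted_wrt_rev
      by (rule sorted_wrt_mono_rel[OF _ sorted_wrt_upt])
         (auto intro!: monotone_onD[OF am])
  qed
  have "L \<zeta> = L \<xi>"
    using properties_for_sort[of "L \<zeta>" "L \<zeta>"] properties_for_sort[of "L \<xi>" "L \<zeta>"] assms mset sorted
    by metis
  then have "\<forall>j\<in>set (rev [1..<Suc (degree f)]). cmod (\<zeta> j) = cmod (\<xi> j)"
    unfolding L_def map_eq_conv .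
  moreover have "i \<in> set (rev [1..<Suc (degree f)])" using assms(3) by auto
  ultimately show ?thesis by blast
qed

text \<open>Replaces the quantification over all orderings in \<open>graeffe_succeeds\<close> by a
  single function of f, whose measurability can be studied. By uniqueness the choice has no effect
  on indices in \<open>{1..degree f}\<close>.\<close>

definition root_modulus :: "complex poly \<Rightarrow> nat \<Rightarrow> real" where
  "root_modulus f i = cmod ((SOME \<zeta>. roots_decreasing f \<zeta>) i)"

lemma root_modulus_eq:
  "roots_decreasing f \<zeta> \<Longrightarrow> i \<in> {1..degree f} \<Longrightarrow> root_modulus f i = cmod (\<zeta> i)"
  unfolding root_modulus_def
  by (rule roots_decreasing_moduli_unique[OF someI[of "roots_decreasing f"]])

text \<open>The component \<open>w 0\<close> is the leading coefficient, \<open>w 1, \<dots>, w d\<close> are the roots.\<close>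

definition coeffs_of_roots :: "nat \<Rightarrow> (nat \<Rightarrow> complex) \<Rightarrow> nat \<Rightarrow> complex" where
  "coeffs_of_roots d w = coeff (smult (w 0) (\<Prod>i\<in>{1..d}. [:- w i, 1:]))"

lemma continuous_on_coeffs_of_roots: "continuous_on UNIV (coeffs_of_roots d)"
proof (rule continuous_on_coordinatewise_then_product)
  fix j
  have "continuous_on UNIV (\<lambda>w::nat \<Rightarrow> complex. coeff (\<Prod>i\<in>{1..d}. [:- w i, 1:]) j)"
  proof (induction d arbitrary: j)
    case (Suc d)
    have "(\<Prod>i\<in>{1..Suc d}. [:- w i, 1:]) =
        pCons 0 (\<Prod>i\<in>{1..d}. [:- w i, 1:]) + smult (- w (Suc d)) (\<Prod>i\<in>{1..d}. [:- w i, 1:])"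
      for w :: "nat \<Rightarrow> complex"
      by (simp add: mult.commute)
    then show ?case
      using Suc by (cases j) (auto intro!: continuous_intros)
  qed simp
  then show "continuous_on UNIV (\<lambda>w. coeffs_of_roots d w j)"
    unfolding coeffs_of_roots_def coeff_smult by (intro continuous_intros) auto
qed

text \<open>Every condition is closed, and all coordinates are bounded, also those beyond d, so
  Tychonoff's theorem gives compactness. The lower bound on |w 0| keeps the leading coefficient away
  from 0, and letting n grow exhausts all root data up to the irrelevant coordinates.\<close>

definition root_box :: "nat \<Rightarrow> nat \<Rightarrow> real \<Rightarrow> nat \<Rightarrow> (nat \<Rightarrow> complex) set" where
  "root_box d i t n = {w. (\<forall>j. cmod (w j) \<le> Suc n) \<and> 1 / Suc n \<le> cmod (w 0) \<and>
     (\<forall>a\<in>{1..d}. \<forall>b\<in>{1..d}. a \<le> b \<longrightarrow> cmod (w b) \<le> cmod (w a)) \<and> t \<le> cmod (w i)}"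

lemma compact_root_box: "compact (root_box d i t n)"
proof -
  have "compactin (product_topology (\<lambda>_. euclidean) UNIV) (\<Pi>\<^sub>E j\<in>UNIV. cball (0::complex) (Suc n) :: (nat \<Rightarrow> complex) set)"
    unfolding compactin_PiE by auto
  then have c: "compact (\<Pi>\<^sub>E j\<in>UNIV. cball (0::complex) (Suc n) :: (nat \<Rightarrow> complex) set)"
    by (simp add: euclidean_product_topology)
  have [continuous_intros]: "continuous_on UNIV (\<lambda>w::nat \<Rightarrow> complex. w j)" for j
    by simp
  have cl: "closed {w::nat \<Rightarrow> complex. 1 / Suc n \<le> cmod (w 0) \<and>
     (\<forall>a\<in>{1..d}. \<forall>b\<in>{1..d}. a \<le> b \<longrightarrow> cmod (w b) \<le> cmod (w a)) \<and> t \<le> cmod (w i)}"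
    unfolding Ball_def
    by (intro closed_Collect_conj closed_Collect_all closed_Collect_imp closed_Collect_le
        open_Collect_const continuous_intros)
  have "root_box d i t n = (\<Pi>\<^sub>E j\<in>UNIV. cball 0 (Suc n)) \<inter> {w. 1 / Suc n \<le> cmod (w 0) \<and>
     (\<forall>a\<in>{1..d}. \<forall>b\<in>{1..d}. a \<le> b \<longrightarrow> cmod (w b) \<le> cmod (w a)) \<and> t \<le> cmod (w i)}"
    by (auto simp: root_box_def PiE_def)
  then show ?thesis using compact_Int_closed[OF c cl] by simp
qed

lemma proots_prod_linear:
  "finite I \<Longrightarrow> proots (\<Prod>i\<in>I. [:- w i, 1:] :: complex poly) = image_mset w (mset_set I)"
proof -
  have "(\<Sum>i\<in>I. {#w i#}) = image_mset w (mset_set I)" if "finite I"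
    using that by (induction I rule: finite_induct) simp_all
  moreover assume "finite I"
  ultimately show ?thesis by (subst proots_prod) simp_all
qed

text \<open>Superlevel sets of the root moduli are countable unions of continuous images of compact sets,
  which is how the measurability of the moduli is obtained.\<close>

lemma root_modulus_ge_eq:
  assumes "d \<ge> 1" "1 \<le> i" "i \<le> d"
  shows "{a. a d \<noteq> 0 \<and> (\<forall>j>d. a j = 0) \<and> t \<le> root_modulus (poly_of_coeffs d a) i} =
    (\<Union>n. coeffs_of_roots d ` root_box d i t n)"
proof (intro equalityI subsetI)
  fix a assume "a \<in> {a. a d \<noteq> 0 \<and> (\<forall>j>d. a j = 0) \<and> t \<le> root_modulus (poly_of_coeffs d a) i}"
  then have a: "a d \<noteq> 0" "\<forall>j>d. a j = 0" "t \<le> root_modulus (poly_of_coeffs d a) i" by auto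
  define f where "f = poly_of_coeffs d a"
  have deg: "degree f = d" using a(1) assms(1) by (simp add: f_def degree_poly_of_coeffs_eq_iff)
  obtain \<zeta> where \<zeta>: "roots_decreasing f \<zeta>" using roots_decreasing_exists by blast
  define w where "w j = (if j = 0 then lead_coeff f else if j \<le> d then \<zeta> j else 0)" for j
  have lc: "lead_coeff f = a d" by (simp only: deg) (simp add: f_def coeff_poly_of_coeffs)
  have "f = smult (w 0) (\<Prod>i\<in>{1..d}. [:- \<zeta> i, 1:])"
    using roots_decreasing_factor[OF \<zeta>] by (simp add: w_def deg)
  also have "(\<Prod>i\<in>{1..d}. [:- \<zeta> i, 1:]) = (\<Prod>i\<in>{1..d}. [:- w i, 1:])"
    by (intro prod.cong) (auto simp: w_def)
  finally have "coeff f = coeffs_of_roots d w" by (simp add: coeffs_of_roots_def)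
  moreover have "coeff f = a"
    using a(2) by (auto simp: fun_eq_iff f_def coeff_poly_of_coeffs not_le)
  ultimately have aw: "a = coeffs_of_roots d w" by simp
  obtain n where n: "(\<Sum>j\<le>d. cmod (w j)) \<le> real n" using real_arch_simple by blast
  obtain m where m: "1 / cmod (a d) \<le> real m" using real_arch_simple by blast
  have bound: "cmod (w j) \<le> Suc (max m n)" for j
  proof (cases "j \<le> d")
    case True
    then have "cmod (w j) \<le> (\<Sum>j\<le>d. cmod (w j))" by (intro member_le_sum) auto
    with n show ?thesis by linarith
  qed (simp add: w_def)
  have "1 / cmod (a d) \<le> Suc (max m n)" using m by linarith
  then have "1 / Suc (max m n) \<le> cmod (w 0)"
    using a(1) by (simp add: w_def lc field_simps)
  moreover have "t \<le> cmod (w i)"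
    using a(3) root_modulus_eq[OF \<zeta>, of i] assms by (simp add: f_def[symmetric] deg w_def)
  moreover have "\<forall>a\<in>{1..d}. \<forall>b\<in>{1..d}. a \<le> b \<longrightarrow> cmod (w b) \<le> cmod (w a)"
    using \<zeta> by (auto simp: roots_decreasing_def deg w_def dest: monotone_onD)
  ultimately have "w \<in> root_box d i t (max m n)" using bound by (simp add: root_box_def)
  then show "a \<in> (\<Union>n. coeffs_of_roots d ` root_box d i t n)" using aw by blast
next
  fix a assume "a \<in> (\<Union>n. coeffs_of_roots d ` root_box d i t n)"
  then obtain n w where w: "w \<in> root_box d i t n" and a: "a = coeffs_of_roots d w" by blast
  define g where "g = smult (w 0) (\<Prod>i\<in>{1..d}. [:- w i, 1:])"
  have "1 / Suc n \<le> cmod (w 0)" using w by (simp add: root_box_def)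
  moreover have "1 / real (Suc n) > 0" by simp
  ultimately have w0: "w 0 \<noteq> 0" by (metis norm_zero not_le)
  have deg: "degree g = d" using w0 by (simp add: g_def degree_prod_linear)
  have ag: "a = coeff g" by (simp add: a g_def coeffs_of_roots_def)
  have big: "\<forall>j>d. a j = 0" using deg by (auto simp: ag coeff_eq_0)
  have "poly_of_coeffs d a = g"
    using big by (intro poly_eqI) (auto simp: coeff_poly_of_coeffs ag)
  moreover have "a d \<noteq> 0" using deg w0 assms(1) by (metis ag degree_0 leading_coeff_0_iff not_one_le_zero)
  moreover have "roots_decreasing g w"
    unfolding roots_decreasing_def deg
    using w w0 by (auto simp: g_def proots_prod_linear root_box_def intro: monotone_onI)
  ultimately show "a \<in> {a. a d \<noteq> 0 \<and> (\<forall>j>d. a j = 0) \<and> t \<le> root_modulus (poly_of_coeffs d a) i}"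
    using big w root_modulus_eq[of g w i] assms by (simp add: deg root_box_def)
qed

lemma root_modulus_measurable:
  assumes "d \<ge> 1" "1 \<le> i" "i \<le> d"
  shows "(\<lambda>v. if v d = 0 then 0 else root_modulus (poly_of_coeffs d v) i) \<in>
    borel_measurable (\<Pi>\<^sub>M i\<in>{..d}. lborel)"
proof -
  let ?L = "\<Pi>\<^sub>M i\<in>{..d}. lborel :: complex measure"
  let ?f = "\<lambda>v. if v d = 0 then 0 else root_modulus (poly_of_coeffs d v) i"
  \<comment> \<open>Vectors of the product space are \<open>undefined\<close> outside
    \<open>{..d}\<close>, whereas coefficient sequences vanish there; E passes from one to the
    other.\<close>
  define E where "E v = (\<lambda>j. if j \<le> d then v j else 0)" for v :: "nat \<Rightarrow> complex"
  have E: "E \<in> ?L \<rightarrow>\<^sub>M borel"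
  proof (rule measurable_coordinatewise_then_product)
    fix j show "(\<lambda>v. E v j) \<in> borel_measurable ?L"
      by (cases "j \<le> d") (simp_all add: E_def)
  qed
  have pE: "poly_of_coeffs d (E v) = poly_of_coeffs d v" for v
    by (intro poly_eqI) (simp add: coeff_poly_of_coeffs E_def)
  have [measurable]: "(\<lambda>v. v d) \<in> borel_measurable ?L" by simp
  have "{v \<in> space ?L. t \<le> ?f v} \<in> sets ?L" for t
  proof -
    have "compact (coeffs_of_roots d ` root_box d i t n)" for n
      by (intro compact_continuous_image compact_root_box
          continuous_on_subset[OF continuous_on_coeffs_of_roots]) auto
    then have "closed (coeffs_of_roots d ` root_box d i t n)" for n
      by (rule compact_imp_closed)
    then have "(\<Union>n. coeffs_of_roots d ` root_box d i t n) \<in> sets borel" by auto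
    from measurable_sets[OF E this]
    have A: "E -` {a. a d \<noteq> 0 \<and> (\<forall>j>d. a j = 0) \<and> t \<le> root_modulus (poly_of_coeffs d a) i} \<inter> space ?L \<in> sets ?L"
      by (simp only: root_modulus_ge_eq[OF assms])
    have B: "{v \<in> space ?L. v d = 0 \<and> t \<le> 0} \<in> sets ?L" by measurable
    have "{v \<in> space ?L. t \<le> ?f v} =
      (E -` {a. a d \<noteq> 0 \<and> (\<forall>j>d. a j = 0) \<and> t \<le> root_modulus (poly_of_coeffs d a) i} \<inter> space ?L)
      \<union> {v \<in> space ?L. v d = 0 \<and> t \<le> 0}"
      by (auto simp: pE) (auto simp: E_def)
    with sets.Un[OF A B] show ?thesis by simp
  qed
  then show ?thesis by (simp only: borel_measurable_iff_ge) blast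
qed

section \<open>Measurability of the success event\<close>

lemma graeffe_coeff_measurable:
  "(\<lambda>v. graeffe_coeff d v k j) \<in> borel_measurable (\<Pi>\<^sub>M i\<in>{..d}. lborel)"
proof (induction k arbitrary: j)
  case 0
  show ?case by (cases "j \<le> d") simp_all
next
  case (Suc k)
  note Suc [measurable]
  show ?case unfolding graeffe_coeff.simps by measurable
qed

definition success_set :: "nat \<Rightarrow> nat \<Rightarrow> real \<Rightarrow> (nat \<Rightarrow> complex) set" where
  "success_set d k b = {v \<in> coeff_vectors d.
     degree (poly_of_coeffs d v) = d \<and> graeffe_succeeds k b (poly_of_coeffs d v)}"

text \<open>A set outside the sigma-algebra has measure 0 by convention, so a positive lower bound
  on the success probability presupposes this. The quantifier over orderings is removed through
  \<open>\<rho>\<close>, by existence of an ordering and uniqueness of the moduli.\<close>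

lemma success_set_measurable:
  assumes d: "d \<ge> 1"
  shows "success_set d k b \<in> sets (coeff_space d)"
proof -
  let ?L = "\<Pi>\<^sub>M i\<in>{..d}. lborel :: complex measure"
  define \<rho> where "\<rho> i v = (if v d = 0 then 0 else root_modulus (poly_of_coeffs d v) i)" for i v
  define x where "x v j = ln (cmod (graeffe_coeff d v k j)) / 2 ^ k" for v j
  have [measurable]: "(\<lambda>v. v d) \<in> borel_measurable ?L" by simp
  have [measurable]: "\<And>j. (\<lambda>v. graeffe_coeff d v k j) \<in> borel_measurable ?L"
    by (rule graeffe_coeff_measurable)
  define Q where "Q j v \<longleftrightarrow> \<bar>x v j - x v (Suc j) - ln (\<rho> (d - j) v)\<bar> \<le> 2 powr (- b) * \<bar>ln (\<rho> (d - j) v)\<bar>" for j v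
  have [measurable]: "Measurable.pred ?L (Q j)" if "j \<in> {..<d}" for j
  proof -
    have [measurable]: "\<rho> (d - j) \<in> borel_measurable ?L"
      unfolding \<rho>_def using that d by (intro root_modulus_measurable) auto
    have [measurable]: "(\<lambda>v. x v i) \<in> borel_measurable ?L" for i
      unfolding x_def by measurable
    have "(\<lambda>v. \<bar>x v j - x v (Suc j) - ln (\<rho> (d - j) v)\<bar>) \<in> borel_measurable ?L"
      "(\<lambda>v. 2 powr (- b) * \<bar>ln (\<rho> (d - j) v)\<bar>) \<in> borel_measurable ?L"
      by measurable
    from borel_measurable_le[OF this] show ?thesis unfolding Q_def pred_def .
  qed
  have "{v \<in> space ?L. v d \<noteq> 0 \<and> (\<forall>j\<in>{..d}. graeffe_coeff d v k j \<noteq> 0) \<and> (\<forall>j\<in>{..<d}. Q j v)} \<in> sets ?L"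
    by measurable
  moreover have "success_set d k b = coeff_vectors d \<inter>
      {v \<in> space ?L. v d \<noteq> 0 \<and> (\<forall>j\<in>{..d}. graeffe_coeff d v k j \<noteq> 0) \<and> (\<forall>j\<in>{..<d}. Q j v)}"
    (is "_ = _ \<inter> ?R")
  proof -
    have "v \<in> success_set d k b \<longleftrightarrow> v \<in> ?R" if v: "v \<in> coeff_vectors d" for v
    proof (cases "v d = 0")
      case True
      then show ?thesis using degree_poly_of_coeffs_eq_iff[OF d, of v] by (simp add: success_set_def)
    next
      case False
      define f where "f = poly_of_coeffs d v"
      have deg: "degree f = d" using False d by (simp add: f_def degree_poly_of_coeffs_eq_iff)
      have co: "coeff ((graeffe ^^ k) f) j = graeffe_coeff d v k j" for j
        unfolding f_def by (rule coeff_graeffe_iterate[of d v, OF d False])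
      have lr: "graeffe_log_root k f j = x v j - x v (Suc j)" for j
        by (simp add: graeffe_log_root_def renormalized_graeffe_def Let_def co x_def)
      have rho: "cmod (\<zeta> (d - j)) = \<rho> (d - j) v" if "roots_decreasing f \<zeta>" "j < d" for \<zeta> j
        using root_modulus_eq[OF that(1), of "d - j"] that(2) False
        by (simp add: \<rho>_def f_def[symmetric] deg)
      have "(\<forall>\<zeta>. roots_decreasing f \<zeta> \<longrightarrow>
          (\<forall>j<d. approximates_rel b (graeffe_log_root k f j) (ln (cmod (\<zeta> (d - j)))))) \<longleftrightarrow>
          (\<forall>j\<in>{..<d}. Q j v)"
        using roots_decreasing_exists[of f] rho
        by (auto simp: approximates_rel_def lr Q_def)
      moreover have "v \<in> space ?L" using v by (auto simp: coeff_vectors_def space_PiM PiE_def)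
      ultimately show ?thesis
        using v False by (auto simp: success_set_def f_def[symmetric] deg graeffe_succeeds_def co)
    qed
    moreover have "success_set d k b \<subseteq> coeff_vectors d" by (auto simp: success_set_def)
    ultimately show ?thesis by blast
  qed
  ultimately show ?thesis
    unfolding coeff_space_def sets_restrict_space by blast
qed

section \<open>Volumes of coefficient vectors with exceptional roots\<close>

abbreviation leb :: "nat set \<Rightarrow> (nat \<Rightarrow> complex) measure" where
  "leb I \<equiv> \<Pi>\<^sub>M i\<in>I. lborel"

lemma emeasure_cball_complex: "r \<ge> 0 \<Longrightarrow> emeasure lborel (cball (c :: complex) r) = ennreal (pi * r\<^sup>2)"
  using emeasure_cball[of r c] unit_ball_vol_2 by simp

text \<open>Fubini: once the other coordinates x are fixed, the condition places \<open>v i\<close>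
  in the disc of radius r around - g x, whose area does not depend on x.\<close>

lemma emeasure_PiM_shear:
  fixes g :: "(nat \<Rightarrow> complex) \<Rightarrow> complex"
  assumes I: "finite I" "i \<notin> I" and B [measurable]: "B \<in> sets (leb I)"
    and g [measurable]: "g \<in> borel_measurable (leb I)" and r: "r \<ge> 0"
  shows "emeasure (leb (insert i I))
      {v \<in> space (leb (insert i I)). restrict v I \<in> B \<and> cmod (v i + g (restrict v I)) \<le> r} =
    emeasure (leb I) B * ennreal (pi * r\<^sup>2)"
proof -
  interpret product_sigma_finite "\<lambda>_::nat. lborel :: complex measure" by unfold_locales
  let ?A = "{v \<in> space (leb (insert i I)). restrict v I \<in> B \<and> cmod (v i + g (restrict v I)) \<le> r}"
  have [measurable]: "(\<lambda>v. restrict v I) \<in> leb (insert i I) \<rightarrow>\<^sub>M leb I"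
    by (rule measurable_restrict_subset) auto
  have A [measurable]: "?A \<in> sets (leb (insert i I))" by measurable
  have "emeasure (leb (insert i I)) ?A = (\<integral>\<^sup>+v. indicator ?A v \<partial>leb (insert i I))"
    by simp
  also have "\<dots> = (\<integral>\<^sup>+x. (\<integral>\<^sup>+y. indicator ?A (x(i := y)) \<partial>lborel) \<partial>leb I)"
    by (rule product_nn_integral_insert) (use I in auto)
  also have "\<dots> = (\<integral>\<^sup>+x. indicator B x * ennreal (pi * r\<^sup>2) \<partial>leb I)"
  proof (rule nn_integral_cong)
    fix x :: "nat \<Rightarrow> complex" assume x: "x \<in> space (leb I)"
    have rx: "restrict (x(i := y)) I = x" for y
      using x I by (auto simp: space_PiM PiE_def extensional_def restrict_def fun_eq_iff)
    have "x(i := y) \<in> space (leb (insert i I))" for y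
      using x by (auto simp: space_PiM PiE_def extensional_def)
    then have "indicator ?A (x(i := y)) = (indicator B x * indicator (cball (- g x) r) y :: ennreal)" for y
      by (auto simp: indicator_def rx dist_norm norm_minus_commute add.commute)
    then show "(\<integral>\<^sup>+y. indicator ?A (x(i := y)) \<partial>lborel) = indicator B x * ennreal (pi * r\<^sup>2)"
      by (simp only:) (subst nn_integral_cmult_indicator, simp, simp add: emeasure_cball_complex r)
  qed
  also have "\<dots> = emeasure (leb I) B * ennreal (pi * r\<^sup>2)"
    by (simp add: nn_integral_multc)
  finally show ?thesis .
qed

text \<open>A product set containing the unit ball; forgetting coordinates gives a polydisc again,
  which suits slicing.\<close>

definition polydisc :: "nat set \<Rightarrow> (nat \<Rightarrow> complex) set" where
  "polydisc I = (\<Pi>\<^sub>E i\<in>I. cball 0 1)"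

lemma polydisc_measurable [measurable]: "finite I \<Longrightarrow> polydisc I \<in> sets (leb I)"
  unfolding polydisc_def by (rule sets_PiM_I_finite) auto

lemma emeasure_polydisc: "finite I \<Longrightarrow> emeasure (leb I) (polydisc I) = ennreal (pi ^ card I)"
proof -
  interpret product_sigma_finite "\<lambda>_::nat. lborel :: complex measure" by unfold_locales
  assume "finite I"
  then have "emeasure (leb I) (polydisc I) = (\<Prod>i\<in>I. emeasure lborel (cball (0::complex) 1))"
    unfolding polydisc_def by (rule emeasure_PiM) auto
  also have "\<dots> = ennreal (pi ^ card I)"
    by (simp add: emeasure_cball_complex ennreal_power)
  finally show ?thesis .
qed

lemma polydisc_imp_space: "v \<in> polydisc I \<Longrightarrow> v \<in> space (leb I)"
  by (auto simp: polydisc_def space_PiM PiE_def)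

lemma restrict_polydisc: "v \<in> polydisc I \<Longrightarrow> J \<subseteq> I \<Longrightarrow> restrict v J \<in> polydisc J"
  by (auto simp: polydisc_def)

definition strip :: "nat set \<Rightarrow> (nat \<Rightarrow> complex) \<Rightarrow> real \<Rightarrow> (nat \<Rightarrow> complex) set" where
  "strip I \<alpha> r = {v \<in> polydisc I. cmod (\<Sum>m\<in>I. \<alpha> m * v m) \<le> r}"

lemma strip_measurable [measurable]: "finite I \<Longrightarrow> strip I \<alpha> r \<in> sets (leb I)"
proof -
  assume I: "finite I"
  have "{v \<in> space (leb I). v \<in> polydisc I \<and> cmod (\<Sum>m\<in>I. \<alpha> m * v m) \<le> r} \<in> sets (leb I)"
    using polydisc_measurable[OF I] by measurable
  moreover have "strip I \<alpha> r = {v \<in> space (leb I). v \<in> polydisc I \<and> cmod (\<Sum>m\<in>I. \<alpha> m * v m) \<le> r}"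
    by (auto simp: strip_def polydisc_imp_space)
  ultimately show ?thesis by simp
qed

text \<open>The coefficient 1 at i turns the linear condition into a disc for \<open>v i\<close>.
  The set B can carry further conditions on the remaining coordinates, so that the elimination can
  be iterated.\<close>

lemma emeasure_inter_strip_le:
  assumes I: "finite I" "i \<in> I" and \<alpha>: "\<alpha> i = 1" and r: "r \<ge> 0"
    and B: "B \<in> sets (leb (I - {i}))" "\<And>v. v \<in> S \<Longrightarrow> restrict v (I - {i}) \<in> B"
    and S: "S \<subseteq> strip I \<alpha> r"
  shows "emeasure (leb I) S \<le> emeasure (leb (I - {i})) B * ennreal (pi * r\<^sup>2)"
proof -
  let ?J = "I - {i}"
  have ins: "insert i ?J = I" using I by auto
  define g where "g x = (\<Sum>m\<in>?J. \<alpha> m * x m)" for x :: "nat \<Rightarrow> complex"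
  have g [measurable]: "g \<in> borel_measurable (leb ?J)" unfolding g_def by measurable
  let ?T = "{v \<in> space (leb (insert i ?J)). restrict v ?J \<in> B \<and> cmod (v i + g (restrict v ?J)) \<le> r}"
  have [measurable]: "(\<lambda>v. restrict v ?J) \<in> leb (insert i ?J) \<rightarrow>\<^sub>M leb ?J"
    by (rule measurable_restrict_subset) auto
  note B(1) [measurable]
  have "?T \<in> sets (leb (insert i ?J))" by measurable
  moreover have "S \<subseteq> ?T"
  proof
    fix v assume v: "v \<in> S"
    then have "v \<in> polydisc I" "cmod (\<Sum>m\<in>I. \<alpha> m * v m) \<le> r" using S by (auto simp: strip_def)
    moreover have "(\<Sum>m\<in>I. \<alpha> m * v m) = v i + g (restrict v ?J)"
      using I \<alpha> by (simp add: g_def sum.remove[of I i])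
    ultimately show "v \<in> ?T" using B(2)[OF v] polydisc_imp_space[of v I] ins by simp
  qed
  ultimately have "emeasure (leb (insert i ?J)) S \<le> emeasure (leb (insert i ?J)) ?T"
    by (intro emeasure_mono)
  also have "\<dots> = emeasure (leb ?J) B * ennreal (pi * r\<^sup>2)"
    by (rule emeasure_PiM_shear) (use I B r in auto)
  finally show ?thesis by (simp only: ins)
qed

lemma emeasure_strip_le:
  assumes "finite I" "i \<in> I" "\<alpha> i = 1" "r \<ge> 0"
  shows "emeasure (leb I) (strip I \<alpha> r) \<le> ennreal (pi ^ (card I - 1) * (pi * r\<^sup>2))"
proof -
  have "emeasure (leb I) (strip I \<alpha> r) \<le>
      emeasure (leb (I - {i})) (polydisc (I - {i})) * ennreal (pi * r\<^sup>2)"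
    by (rule emeasure_inter_strip_le[where \<alpha> = \<alpha>]) (use assms in \<open>auto simp: strip_def intro: restrict_polydisc\<close>)
  then show ?thesis
    using assms by (simp add: emeasure_polydisc ennreal_mult'')
qed

text \<open>On the coordinates i, j the two forms are triangular with unit diagonal: as \<beta>
  vanishes at i, the second condition survives the elimination of \<open>v i\<close> and then
  confines \<open>v j\<close>. No lower bound on a determinant has to be found.\<close>

lemma emeasure_two_strips_le:
  assumes I: "finite I" "i \<in> I" "j \<in> I" "i \<noteq> j" and \<alpha>: "\<alpha> i = 1" and \<beta>: "\<beta> i = 0" "\<beta> j = 1"
    and r: "r \<ge> 0"
  shows "emeasure (leb I) (strip I \<alpha> r \<inter> strip I \<beta> r) \<le> ennreal (pi ^ (card I - 2) * (pi * r\<^sup>2)\<^sup>2)"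
proof -
  let ?J = "I - {i}"
  have "emeasure (leb I) (strip I \<alpha> r \<inter> strip I \<beta> r) \<le>
      emeasure (leb ?J) (strip ?J \<beta> r) * ennreal (pi * r\<^sup>2)"
  proof (rule emeasure_inter_strip_le[where \<alpha> = \<alpha>])
    fix v assume "v \<in> strip I \<alpha> r \<inter> strip I \<beta> r"
    then show "restrict v ?J \<in> strip ?J \<beta> r"
      using I \<beta> by (auto simp: strip_def sum.remove[of I i] intro: restrict_polydisc)
  qed (use assms in auto)
  also have "\<dots> \<le> ennreal (pi ^ (card ?J - 1) * (pi * r\<^sup>2)) * ennreal (pi * r\<^sup>2)"
    by (intro mult_right_mono emeasure_strip_le[of _ j]) (use assms in auto)
  also have "\<dots> = ennreal (pi ^ (card I - 2) * (pi * r\<^sup>2)\<^sup>2)"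
    using I by (simp add: ennreal_mult''[symmetric] power2_eq_square mult.assoc numeral_2_eq_2)
  finally show ?thesis .
qed

text \<open>\<open>divdiff n z w = (z ^ n - w ^ n) / (z - w)\<close>, continued to the diagonal.\<close>

fun divdiff :: "nat \<Rightarrow> complex \<Rightarrow> complex \<Rightarrow> complex" where
  "divdiff 0 z w = 0"
| "divdiff (Suc n) z w = z * divdiff n z w + w ^ n"

section \<open>Perturbation of powers and divided differences on the disc of radius 2\<close>

lemma norm_power_diff_le:
  assumes "cmod z \<le> 2" "cmod w \<le> 2" "cmod (z - w) \<le> t"
  shows "cmod (z ^ n - w ^ n) \<le> real n * 2 ^ n * t"
proof (induction n)
  case (Suc n)
  have t: "t \<ge> 0" using assms(3) norm_ge_zero order_trans by blast
  have "z ^ Suc n - w ^ Suc n = z * (z ^ n - w ^ n) + (z - w) * w ^ n"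
    by (simp add: algebra_simps)
  also have "cmod \<dots> \<le> cmod (z * (z ^ n - w ^ n)) + cmod ((z - w) * w ^ n)"
    by (rule norm_triangle_ineq)
  also have "\<dots> \<le> 2 * (real n * 2 ^ n * t) + t * 2 ^ n"
    unfolding norm_mult norm_power
    by (intro add_mono mult_mono Suc power_mono) (use assms t in auto)
  also have "\<dots> \<le> real (Suc n) * 2 ^ Suc n * t" using t by (simp add: algebra_simps)
  finally show ?case .
qed simp

lemma norm_divdiff_le:
  assumes "cmod z \<le> 2" "cmod w \<le> 2"
  shows "cmod (divdiff n z w) \<le> real n * 2 ^ n"
proof (induction n)
  case (Suc n)
  have "cmod (divdiff (Suc n) z w) \<le> cmod (z * divdiff n z w) + cmod (w ^ n)"
    by (simp add: norm_triangle_ineq)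
  also have "\<dots> \<le> 2 * (real n * 2 ^ n) + 2 ^ n"
    unfolding norm_mult norm_power
    by (intro add_mono mult_mono Suc power_mono) (use assms in auto)
  also have "\<dots> \<le> real (Suc n) * 2 ^ Suc n" by (simp add: algebra_simps)
  finally show ?case .
qed simp

lemma norm_divdiff_diff_le:
  assumes "cmod z \<le> 2" "cmod w \<le> 2" "cmod z' \<le> 2" "cmod w' \<le> 2"
    and "cmod (z - z') \<le> t" "cmod (w - w') \<le> t"
  shows "cmod (divdiff n z w - divdiff n z' w') \<le> real n ^ 2 * 2 ^ n * t"
proof (induction n)
  case (Suc n)
  have t: "t \<ge> 0" using assms(5) norm_ge_zero order_trans by blast
  have "divdiff (Suc n) z w - divdiff (Suc n) z' w' =
      z * (divdiff n z w - divdiff n z' w') + (z - z') * divdiff n z' w' + (w ^ n - w' ^ n)"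
    by (simp add: algebra_simps)
  also have "cmod \<dots> \<le> cmod (z * (divdiff n z w - divdiff n z' w')) +
      cmod ((z - z') * divdiff n z' w') + cmod (w ^ n - w' ^ n)"
    by (rule order_trans[OF norm_triangle_ineq add_right_mono[OF norm_triangle_ineq]])
  also have "\<dots> \<le> 2 * (real n ^ 2 * 2 ^ n * t) + t * (real n * 2 ^ n) + real n * 2 ^ n * t"
    unfolding norm_mult
    by (intro add_mono mult_mono Suc norm_divdiff_le norm_power_diff_le) (use assms t in auto)
  also have "\<dots> \<le> real (Suc n) ^ 2 * 2 ^ Suc n * t"
    using t by (simp add: power2_eq_square algebra_simps)
  finally show ?case .
qed simp

text \<open>Passes from an exact linear relation at a root to an approximate one at a nearby net
  point.\<close>

lemma norm_sum_mult_perturb: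
  fixes v a b :: "nat \<Rightarrow> complex"
  assumes v: "v \<in> polydisc {..d}" and z: "(\<Sum>m\<le>d. a m * v m) = 0"
    and ab: "\<And>m. m \<le> d \<Longrightarrow> cmod (a m - b m) \<le> L"
  shows "cmod (\<Sum>m\<le>d. b m * v m) \<le> real (d + 1) * L"
proof -
  have "(\<Sum>m\<le>d. b m * v m) = - (\<Sum>m\<le>d. (a m - b m) * v m)"
    using z by (simp add: left_diff_distrib sum_subtractf)
  also have "cmod \<dots> \<le> (\<Sum>m\<le>d. L * 1)"
  proof (unfold norm_minus_cancel, rule sum_norm_le)
    fix m assume m: "m \<in> {..d}"
    then have vm: "cmod (v m) \<le> 1" using v by (auto simp: polydisc_def PiE_def Pi_def)
    have "L \<ge> 0" using ab[of m] m norm_ge_zero order_trans by (metis atMost_iff)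
    then show "cmod ((a m - b m) * v m) \<le> L * 1"
      unfolding norm_mult using ab[of m] m vm by (intro mult_mono) auto
  qed
  finally show ?thesis by (simp add: algebra_simps)
qed

text \<open>A polar grid, so that two points of nearly equal modulus can share the radial
  index.\<close>

definition net_point :: "nat \<Rightarrow> nat \<Rightarrow> nat \<Rightarrow> complex" where
  "net_point N m n = of_real (m / N) * cis (n / N)"

lemma norm_cis_diff_le: "cmod (cis a - cis b) \<le> \<bar>a - b\<bar>"
proof -
  have "cis a - cis b = cis b * (cis (a - b) - 1)"
    by (simp add: right_diff_distrib cis_mult)
  then have "cmod (cis a - cis b) = cmod (cis (a - b) - 1)" by (simp add: norm_mult)
  also have "\<dots> \<le> \<bar>a - b\<bar>" using iexp_approx1[of "a - b" 0] by (simp add: cis_conv_exp)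
  finally show ?thesis .
qed

lemma ex_grid_point:
  assumes "N \<ge> 1" "0 \<le> x" "x \<le> real c"
  obtains n :: nat where "n \<le> c * N" "\<bar>x - n / N\<bar> \<le> 1 / N"
proof
  define n where "n = nat \<lfloor>x * N\<rfloor>"
  have n: "real n \<le> x * N" "x * N \<le> real n + 1"
    using assms by (auto simp: n_def)
  have "x * N \<le> real c * N" using assms by (intro mult_right_mono) auto
  then have "real n \<le> real (c * N)" using n by simp
  then show "n \<le> c * N" by (simp only: of_nat_le_iff)
  have "x - n / N = (x * N - n) / N" using assms by (simp add: diff_divide_distrib)
  moreover have "\<bar>x * N - n\<bar> / N \<le> 1 / N" using n by (intro divide_right_mono) auto
  ultimately show "\<bar>x - n / N\<bar> \<le> 1 / N" by simp
qed

text \<open>The bound 7 N comes from 2 pi < 7. The angular index serves every radial index m, which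
  lets the radius be prescribed separately, by another root or by the unit circle.\<close>

lemma ex_net_angle:
  assumes "N \<ge> 1"
  obtains n where "n \<le> 7 * N"
    "\<And>m. cmod (\<zeta> - net_point N m n) \<le> \<bar>cmod \<zeta> - m / N\<bar> + m / N * (1 / N)"
proof -
  define \<theta> where "\<theta> = Arg2pi \<zeta>"
  have \<theta>: "0 \<le> \<theta>" "\<theta> < 2 * pi" "\<zeta> = of_real (cmod \<zeta>) * cis \<theta>"
    using Arg2pi[of \<zeta>] by (auto simp: \<theta>_def cis_conv_exp is_Arg_def)
  have "\<theta> \<le> real 7" using \<theta>(2) pi_approx by simp
  then obtain n where n: "n \<le> 7 * N" "\<bar>\<theta> - n / N\<bar> \<le> 1 / N"
    using ex_grid_point[OF assms \<theta>(1)] by blast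
  have c: "cmod (cis \<theta> - cis (n / N)) \<le> 1 / N"
    by (rule order_trans[OF norm_cis_diff_le n(2)])
  have "cmod (\<zeta> - net_point N m n) \<le> \<bar>cmod \<zeta> - m / N\<bar> + m / N * (1 / N)" for m
  proof -
    have "\<zeta> - net_point N m n =
        of_real (cmod \<zeta> - m / N) * cis \<theta> + of_real (m / N) * (cis \<theta> - cis (n / N))"
      unfolding net_point_def by (subst \<theta>(3)) (simp add: algebra_simps)
    also have "cmod \<dots> \<le> cmod (of_real (cmod \<zeta> - m / N) * cis \<theta>) +
        cmod (of_real (m / N) * (cis \<theta> - cis (n / N)))"
      by (rule norm_triangle_ineq)
    also have "\<dots> = \<bar>cmod \<zeta> - m / N\<bar> + m / N * cmod (cis \<theta> - cis (n / N))"
      unfolding norm_mult norm_of_real norm_cis by simp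
    also have "\<dots> \<le> \<bar>cmod \<zeta> - m / N\<bar> + m / N * (1 / N)"
      by (intro add_left_mono mult_left_mono c) auto
    finally show ?thesis .
  qed
  then show ?thesis using n(1) that by blast
qed

lemma degree_weight_le:
  assumes "n \<le> d" "t \<ge> 0"
  shows "real n * 2 ^ n * t \<le> real d ^ 2 * 2 ^ d * t"
    and "real n ^ 2 * 2 ^ n * t \<le> real d ^ 2 * 2 ^ d * t"
proof -
  have "real n \<le> real n ^ 2" by (cases n) (auto simp: power2_eq_square)
  moreover have n2: "real n ^ 2 \<le> real d ^ 2" using assms by (intro power_mono) auto
  ultimately have n1: "real n \<le> real d ^ 2" by linarith
  have p: "(2::real) ^ n \<le> 2 ^ d" using assms by (intro power_increasing) auto
  show "real n * 2 ^ n * t \<le> real d ^ 2 * 2 ^ d * t"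
    by (rule mult_right_mono[OF mult_mono[OF n1 p]]) (use assms in auto)
  show "real n ^ 2 * 2 ^ n * t \<le> real d ^ 2 * 2 ^ d * t"
    by (rule mult_right_mono[OF mult_mono[OF n2 p]]) (use assms in auto)
qed

text \<open>The factor relating a displacement of the points to the resulting change of either
  linear form: d + 1 summands, with powers and divided differences changing by at most d^2 2^d times
  the displacement.\<close>

definition perturb_bound :: "nat \<Rightarrow> real" where
  "perturb_bound d = real (d + 1) * (real d ^ 2 * 2 ^ d)"

text \<open>The divided difference expresses that \<open>\<zeta>\<close> and \<open>\<xi>\<close> are roots counted with multiplicity, also for \<open>\<zeta> = \<xi>\<close>.
  The exponents \<open>e m\<close> are \<open>m\<close> for the polynomial itself and \<open>d - m\<close> for its reversal.\<close>

definition close_pair :: "(nat \<Rightarrow> nat) \<Rightarrow> nat \<Rightarrow> nat \<Rightarrow> (nat \<Rightarrow> complex) set" where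
  "close_pair e d N = {v \<in> polydisc {..d}. \<exists>\<zeta> \<xi>. cmod \<zeta> \<le> 2 \<and> cmod \<xi> \<le> 2 \<and>
     \<bar>cmod \<zeta> - cmod \<xi>\<bar> \<le> 1 / N \<and>
     (\<Sum>m\<le>d. \<zeta> ^ e m * v m) = 0 \<and> (\<Sum>m\<le>d. divdiff (e m) \<zeta> \<xi> * v m) = 0}"

lemma emeasure_UN_le_card:
  fixes c C :: real
  assumes "finite A" "\<And>a. a \<in> A \<Longrightarrow> S a \<in> sets M" "\<And>a. a \<in> A \<Longrightarrow> emeasure M (S a) \<le> ennreal c"
    "c \<ge> 0" "card A * c \<le> C"
  shows "emeasure M (\<Union>a\<in>A. S a) \<le> ennreal C"
proof -
  have "emeasure M (\<Union>a\<in>A. S a) \<le> (\<Sum>a\<in>A. emeasure M (S a))"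
    by (intro emeasure_subadditive_finite) (use assms in auto)
  also have "\<dots> \<le> (\<Sum>a\<in>A. ennreal c)" by (intro sum_mono assms)
  also have "\<dots> = ennreal (card A * c)"
    by (simp add: ennreal_mult' assms ennreal_of_nat_eq_real_of_nat)
  also have "\<dots> \<le> ennreal C" by (intro ennreal_leI assms)
  finally show ?thesis .
qed

text \<open>The set is described by an existential over a continuum of roots, so a measurable cover
  is bounded instead of the set itself. The indices i, j carry the exponents 0 and 1, where the
  powers take the value 1 at i and the divided differences take the values 0 at i and 1 at j, as the
  two-strip bound requires.\<close>

lemma close_pair_cover:
  assumes d: "d \<ge> 1" and N: "N \<ge> 1" and e: "\<And>m. m \<le> d \<Longrightarrow> e m \<le> d"
    and ij: "i \<le> d" "j \<le> d" "e i = 0" "e j = 1"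
  shows "\<exists>U\<in>sets (leb {..d}). close_pair e d N \<subseteq> U \<and>
    emeasure (leb {..d}) U \<le>
      ennreal (192 * (pi ^ (d - 1) * (16 * pi * (perturb_bound d)\<^sup>2)\<^sup>2) / N)"
proof -
  \<comment> \<open>The angular error is at most 2/N, since the radius is at most 2. The radial
    error is 1/N for \<zeta> and 2/N for \<xi>, hence 4/N in all.\<close>
  define r where "r = perturb_bound d * (4 / N)"
  define S where "S = (\<lambda>(m, n, n').
      strip {..d} (\<lambda>l. net_point N m n ^ e l) r \<inter>
      strip {..d} (\<lambda>l. divdiff (e l) (net_point N m n) (net_point N m n')) r)"
  \<comment> \<open>A single radial index serves both points, as the moduli differ by at most
    1/N.\<close>
  define A where "A = {..2 * N} \<times> {..7 * N} \<times> {..7 * N}"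
  define c where "c = pi ^ (d - 1) * (pi * r\<^sup>2)\<^sup>2"
  have r0: "r \<ge> 0" by (simp add: r_def perturb_bound_def)
  have close: "close_pair e d N \<subseteq> (\<Union>a\<in>A. S a)"
  proof
    fix v assume v: "v \<in> close_pair e d N"
    then obtain \<zeta> \<xi> where z: "cmod \<zeta> \<le> 2" "cmod \<xi> \<le> 2" "\<bar>cmod \<zeta> - cmod \<xi>\<bar> \<le> 1 / N"
      "(\<Sum>m\<le>d. \<zeta> ^ e m * v m) = 0" "(\<Sum>m\<le>d. divdiff (e m) \<zeta> \<xi> * v m) = 0"
      by (auto simp: close_pair_def)
    have vp: "v \<in> polydisc {..d}" using v by (simp add: close_pair_def)
    obtain m where m2: "m \<le> 2 * N" and zm: "\<bar>cmod \<zeta> - m / N\<bar> \<le> 1 / N"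
      using ex_grid_point[OF N, of "cmod \<zeta>" 2] z(1) by auto
    obtain n where n: "n \<le> 7 * N"
      "\<And>m. cmod (\<zeta> - net_point N m n) \<le> \<bar>cmod \<zeta> - m / N\<bar> + m / N * (1 / N)"
      using ex_net_angle[OF N] by blast
    obtain n' where n': "n' \<le> 7 * N"
      "\<And>m. cmod (\<xi> - net_point N m n') \<le> \<bar>cmod \<xi> - m / N\<bar> + m / N * (1 / N)"
      using ex_net_angle[OF N] by blast
    have mN: "m / N * (1 / N) \<le> 2 * (1 / N)"
      using m2 N by (intro mult_right_mono) (auto simp: field_simps)
    have xm: "\<bar>cmod \<xi> - m / N\<bar> \<le> 1 / N + 1 / N" using z(3) zm by linarith
    define z where "z = net_point N m n"
    define w where "w = net_point N m n'"
    have zz: "cmod (\<zeta> - z) \<le> 4 / N" "cmod (\<xi> - w) \<le> 4 / N"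
      using n(2)[of m] n'(2)[of m] mN zm xm by (simp_all add: z_def w_def)
    have "cmod z \<le> 2" "cmod w \<le> 2"
      using m2 N by (simp_all add: z_def w_def net_point_def norm_mult norm_divide field_simps)
    note bounds = \<open>cmod \<zeta> \<le> 2\<close> \<open>cmod \<xi> \<le> 2\<close> this zz
    have req: "real (d + 1) * (real d ^ 2 * 2 ^ d * (4 / N)) = r"
      by (simp add: r_def perturb_bound_def)
    have "cmod (\<Sum>l\<le>d. z ^ e l * v l) \<le> real (d + 1) * (real d ^ 2 * 2 ^ d * (4 / N))"
      by (rule norm_sum_mult_perturb[OF vp \<open>(\<Sum>m\<le>d. \<zeta> ^ e m * v m) = 0\<close>],
          rule order_trans[OF norm_power_diff_le[OF bounds(1,3,5)] degree_weight_le(1)[OF e]]) auto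
    moreover have "cmod (\<Sum>l\<le>d. divdiff (e l) z w * v l) \<le> real (d + 1) * (real d ^ 2 * 2 ^ d * (4 / N))"
      by (rule norm_sum_mult_perturb[OF vp \<open>(\<Sum>m\<le>d. divdiff (e m) \<zeta> \<xi> * v m) = 0\<close>],
          rule order_trans[OF norm_divdiff_diff_le[OF bounds] degree_weight_le(2)[OF e]]) auto
    ultimately have "v \<in> S (m, n, n')"
      unfolding req using vp by (simp add: S_def strip_def z_def w_def)
    moreover have "(m, n, n') \<in> A" using m2 n n' by (simp add: A_def)
    ultimately show "v \<in> (\<Union>a\<in>A. S a)" by blast
  qed
  have "emeasure (leb {..d}) (\<Union>a\<in>A. S a) \<le>
      ennreal (192 * (pi ^ (d - 1) * (16 * pi * (perturb_bound d)\<^sup>2)\<^sup>2) / N)"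
  proof (rule emeasure_UN_le_card)
    fix a assume "a \<in> A"
    obtain m n n' where a: "a = (m, n, n')" by (metis prod_cases3)
    have "i \<noteq> j" using ij by auto
    then show "emeasure (leb {..d}) (S a) \<le> ennreal c"
      using emeasure_two_strips_le[of "{..d}" i j "\<lambda>l. net_point N m n ^ e l"
          "\<lambda>l. divdiff (e l) (net_point N m n) (net_point N m n')" r] ij r0
      by (simp add: a S_def c_def)
  next
    \<comment> \<open>About 192 N^3 triples meet volumes proportional to r^4, that is to 1/N^4,
      which leaves 1/N.\<close>
    have "real (card A) = (2 * N + 1) * (7 * N + 1)\<^sup>2"
      by (simp add: A_def power2_eq_square)
    also have "\<dots> \<le> (3 * N) * (8 * N)\<^sup>2"
      using N by (intro mult_mono power_mono of_nat_mono) auto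
    also have "\<dots> = 192 * real N ^ 3" by (simp add: power2_eq_square power3_eq_cube)
    finally have "card A * c \<le> 192 * real N ^ 3 * c"
      by (intro mult_right_mono) (auto simp: c_def)
    also have "\<dots> = 192 * (pi ^ (d - 1) * (16 * pi * (perturb_bound d)\<^sup>2)\<^sup>2) / N"
      using N by (simp add: c_def r_def field_simps power2_eq_square power3_eq_cube)
    finally show "card A * c \<le> 192 * (pi ^ (d - 1) * (16 * pi * (perturb_bound d)\<^sup>2)\<^sup>2) / N" .
  qed (auto simp: A_def S_def c_def split: prod.splits)
  moreover have "(\<Union>a\<in>A. S a) \<in> sets (leb {..d})"
    by (rule sets.finite_UN) (auto simp: A_def S_def)
  ultimately show ?thesis using close by blast
qed

definition near_circle :: "nat \<Rightarrow> nat \<Rightarrow> (nat \<Rightarrow> complex) set" where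
  "near_circle d N = {v \<in> polydisc {..d}. \<exists>\<zeta>. \<bar>cmod \<zeta> - 1\<bar> \<le> 1 / N \<and> (\<Sum>m\<le>d. \<zeta> ^ m * v m) = 0}"

text \<open>The radial index is fixed at N, so the net points lie on the unit circle. Radial and
  angular errors of 1/N each give the 2/N in r.\<close>

lemma near_circle_cover:
  assumes d: "d \<ge> 1" and N: "N \<ge> 1"
  shows "\<exists>U\<in>sets (leb {..d}). near_circle d N \<subseteq> U \<and>
    emeasure (leb {..d}) U \<le> ennreal (8 * (pi ^ d * (4 * pi * (perturb_bound d)\<^sup>2)) / N)"
proof -
  define r where "r = perturb_bound d * (2 / N)"
  define S where "S n = strip {..d} (\<lambda>l. net_point N N n ^ l) r" for n
  define c where "c = pi ^ d * (pi * r\<^sup>2)"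
  have r0: "r \<ge> 0" by (simp add: r_def perturb_bound_def)
  have close: "near_circle d N \<subseteq> (\<Union>n\<in>{..7 * N}. S n)"
  proof
    fix v assume v: "v \<in> near_circle d N"
    then obtain \<zeta> where z: "\<bar>cmod \<zeta> - 1\<bar> \<le> 1 / N" "(\<Sum>m\<le>d. \<zeta> ^ m * v m) = 0"
      by (auto simp: near_circle_def)
    have vp: "v \<in> polydisc {..d}" using v by (simp add: near_circle_def)
    obtain n where n: "n \<le> 7 * N"
      "\<And>m. cmod (\<zeta> - net_point N m n) \<le> \<bar>cmod \<zeta> - m / N\<bar> + m / N * (1 / N)"
      using ex_net_angle[OF N] by blast
    define w where "w = net_point N N n"
    have "1 / real N \<le> 1" using N by simp
    then have "cmod \<zeta> \<le> 2" using z(1) by linarith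
    moreover have "cmod w \<le> 2" using N by (simp add: w_def net_point_def norm_mult norm_divide)
    moreover have "cmod (\<zeta> - w) \<le> 2 / N"
      using n(2)[of N] z(1) N by (simp add: w_def)
    ultimately have pd: "cmod (\<zeta> ^ l - w ^ l) \<le> real l * 2 ^ l * (2 / N)" for l
      by (rule norm_power_diff_le)
    have "cmod (\<Sum>l\<le>d. w ^ l * v l) \<le> real (d + 1) * (real d ^ 2 * 2 ^ d * (2 / N))"
    proof (rule norm_sum_mult_perturb[OF vp z(2)])
      fix l assume l: "l \<le> d"
      have "real l * 2 ^ l * (2 / N) \<le> real d ^ 2 * 2 ^ d * (2 / N)"
        by (rule degree_weight_le(1)[OF l]) simp
      with pd show "cmod (\<zeta> ^ l - w ^ l) \<le> real d ^ 2 * 2 ^ d * (2 / N)"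
        by (rule order_trans)
    qed
    also have "real (d + 1) * (real d ^ 2 * 2 ^ d * (2 / N)) = r"
      by (simp add: r_def perturb_bound_def)
    finally have "v \<in> S n" using vp by (simp add: S_def strip_def w_def)
    then show "v \<in> (\<Union>n\<in>{..7 * N}. S n)" using n(1) by auto
  qed
  have "emeasure (leb {..d}) (\<Union>n\<in>{..7 * N}. S n) \<le>
      ennreal (8 * (pi ^ d * (4 * pi * (perturb_bound d)\<^sup>2)) / N)"
  proof (rule emeasure_UN_le_card)
    fix n
    show "emeasure (leb {..d}) (S n) \<le> ennreal c"
      using emeasure_strip_le[of "{..d}" 0 "\<lambda>l. net_point N N n ^ l" r] r0
      by (simp add: S_def c_def)
  next
    have "real (card {..7 * N}) * c \<le> (8 * N) * c"
      using N by (intro mult_right_mono) (auto simp: c_def)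
    also have "\<dots> = 8 * (pi ^ d * (4 * pi * (perturb_bound d)\<^sup>2)) / N"
      using N by (simp add: c_def r_def field_simps power2_eq_square)
    finally show "real (card {..7 * N}) * c \<le> 8 * (pi ^ d * (4 * pi * (perturb_bound d)\<^sup>2)) / N" .
  qed (auto simp: S_def c_def)
  moreover have "(\<Union>n\<in>{..7 * N}. S n) \<in> sets (leb {..d})"
    by (rule sets.finite_UN) (auto simp: S_def)
  ultimately show ?thesis using close by blast
qed

text \<open>Disposes of vectors with a root at 0 (i = 0) or of lower degree (i = d), as a strip of
  width 0.\<close>

lemma coordinate_zero_null:
  assumes "i \<le> d"
  shows "{v \<in> polydisc {..d}. v i = 0} \<in> null_sets (leb {..d})"
proof -
  define \<alpha> :: "nat \<Rightarrow> complex" where "\<alpha> m = (if m = i then 1 else 0)" for m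
  have "\<alpha> m * v m = (if m = i then v m else 0)" for v :: "nat \<Rightarrow> complex" and m
    by (simp add: \<alpha>_def)
  then have *: "(\<Sum>m\<le>d. \<alpha> m * v m) = v i" for v :: "nat \<Rightarrow> complex"
    using assms by simp
  have "strip {..d} \<alpha> 0 = {v \<in> polydisc {..d}. v i = 0}"
    using * by (auto simp: strip_def)
  moreover have "emeasure (leb {..d}) (strip {..d} \<alpha> 0) \<le> ennreal 0"
    using emeasure_strip_le[of "{..d}" i \<alpha> 0] assms by (simp add: \<alpha>_def)
  ultimately show ?thesis
    using strip_measurable[of "{..d}" \<alpha> 0] by (auto simp: null_sets_def)
qed

section \<open>Convergence outside the exceptional sets\<close>

lemma poly_eq_sum_atMost:
  fixes p :: "complex poly"
  assumes "degree p \<le> n"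
  shows "poly p x = (\<Sum>m\<le>n. x ^ m * coeff p m)"
  unfolding poly_altdef
  by (rule sum.mono_neutral_cong_left) (use assms in \<open>auto simp: coeff_eq_0 mult.commute\<close>)

text \<open>Off the diagonal both sides are (p(z) - p(w)) / (z - w). The induction avoids this
  quotient: the recursion of \<open>divdiff\<close> is that of synthetic division, so z = w needs no
  separate case.\<close>

lemma sum_divdiff_eq_poly_synthetic_div:
  assumes "degree p \<le> n"
  shows "(\<Sum>m\<le>n. divdiff m z w * coeff p m) = poly (synthetic_div p w) z"
  using assms
proof (induction p arbitrary: n)
  case (pCons c p)
  show ?case
  proof (cases n)
    case 0
    with pCons show ?thesis by (cases "p = 0") auto
  next
    case (Suc l)
    have deg: "degree p \<le> l" using pCons.prems Suc by (cases "p = 0") auto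
    have "(\<Sum>m\<le>Suc l. divdiff m z w * coeff (pCons c p) m) =
        (\<Sum>m\<le>l. z * (divdiff m z w * coeff p m) + w ^ m * coeff p m)"
      by (subst sum.atMost_Suc_shift) (simp add: algebra_simps)
    also have "\<dots> = z * poly (synthetic_div p w) z + (\<Sum>m\<le>l. w ^ m * coeff p m)"
      by (simp add: sum.distrib sum_distrib_left[symmetric] pCons.IH[OF deg])
    also have "(\<Sum>m\<le>l. w ^ m * coeff p m) = poly p w"
      by (rule poly_eq_sum_atMost[OF deg, symmetric])
    finally show ?thesis by (simp add: Suc)
  qed
qed simp

text \<open>Dividing p by x - w leaves a polynomial that still vanishes at z, also when z = w; the
  factored hypothesis records this multiplicity.\<close>

lemma two_roots_sums_vanish:
  assumes p: "p = [:- w, 1:] * ([:- z, 1:] * q)" and n: "degree p \<le> n"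
  shows "(\<Sum>m\<le>n. z ^ m * coeff p m) = 0" "(\<Sum>m\<le>n. divdiff m z w * coeff p m) = 0"
proof -
  have "(\<Sum>m\<le>n. z ^ m * coeff p m) = poly p z"
    by (rule poly_eq_sum_atMost[OF n, symmetric])
  then show "(\<Sum>m\<le>n. z ^ m * coeff p m) = 0" by (simp add: p)
  have "poly p w = 0" by (simp add: p)
  then have "[:- w, 1:] * synthetic_div p w = [:- w, 1:] * ([:- z, 1:] * q)"
    using synthetic_div_correct'[of w p] p by simp
  then have "synthetic_div p w = [:- z, 1:] * q"
    by (rule mult_left_cancel[THEN iffD1, rotated]) simp
  then show "(\<Sum>m\<le>n. divdiff m z w * coeff p m) = 0"
    using sum_divdiff_eq_poly_synthetic_div[OF n, of z w] by simp
qed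

lemma reflect_poly_linear:
  "a \<noteq> 0 \<Longrightarrow> reflect_poly [:- a, 1:] = smult (- a) [:- inverse a, 1 :: complex:]"
  by (simp add: reflect_poly_pCons)

lemma close_pairI:
  assumes "v \<in> polydisc {..d}" "cmod \<zeta> \<le> 2" "cmod \<xi> \<le> 2" "\<bar>cmod \<zeta> - cmod \<xi>\<bar> \<le> 1 / N"
    "(\<Sum>m\<le>d. \<zeta> ^ e m * v m) = 0" "(\<Sum>m\<le>d. divdiff (e m) \<zeta> \<xi> * v m) = 0"
  shows "v \<in> close_pair e d N"
  using assms unfolding close_pair_def by blast

lemma two_roots_close_pair:
  assumes v: "v \<in> polydisc {..d}" and vd: "v d \<noteq> 0" and d: "d \<ge> 1"
    and p: "poly_of_coeffs d v = [:- w, 1:] * ([:- z, 1:] * q)"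
  shows "v \<notin> close_pair (\<lambda>m. m) d N \<Longrightarrow> cmod z \<le> 2 \<Longrightarrow> cmod w \<le> 2 \<Longrightarrow> \<bar>cmod z - cmod w\<bar> > 1 / N"
    and "v \<notin> close_pair (\<lambda>m. d - m) d N \<Longrightarrow> z \<noteq> 0 \<Longrightarrow> w \<noteq> 0 \<Longrightarrow>
      inverse (cmod z) \<le> 2 \<Longrightarrow> inverse (cmod w) \<le> 2 \<Longrightarrow>
      \<bar>inverse (cmod z) - inverse (cmod w)\<bar> > 1 / N"
proof -
  define f where "f = poly_of_coeffs d v"
  have deg: "degree f = d" using vd d by (simp add: f_def degree_poly_of_coeffs_eq_iff)
  have co: "coeff f m = v m" if "m \<le> d" for m using that by (simp add: f_def coeff_poly_of_coeffs)
  have sco: "(\<Sum>m\<le>d. g m * v m) = (\<Sum>m\<le>d. g m * coeff f m)" for g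
    by (intro sum.cong) (auto simp: co)
  have z0: "(\<Sum>m\<le>d. z ^ m * v m) = 0" "(\<Sum>m\<le>d. divdiff m z w * v m) = 0"
    unfolding sco using two_roots_sums_vanish[OF p[folded f_def], of d] deg by auto
  show "\<bar>cmod z - cmod w\<bar> > 1 / N"
    if "v \<notin> close_pair (\<lambda>m. m) d N" "cmod z \<le> 2" "cmod w \<le> 2"
    using close_pairI[OF v that(2,3) _ z0] that(1) not_le by blast
  assume v': "v \<notin> close_pair (\<lambda>m. d - m) d N" and zw: "z \<noteq> 0" "w \<noteq> 0"
    "inverse (cmod z) \<le> 2" "inverse (cmod w) \<le> 2"
  \<comment> \<open>Reversal is multiplicative and sends x - a to - a (x - 1/a); the two constants
    combine to z w and are absorbed in the cofactor.\<close>
  have "reflect_poly f = [:- inverse w, 1:] * ([:- inverse z, 1:] * smult (z * w) (reflect_poly q))"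
    unfolding p[folded f_def] reflect_poly_mult reflect_poly_linear[OF zw(1)] reflect_poly_linear[OF zw(2)]
    by (simp only: mult_smult_left mult_smult_right smult_smult) simp
  note * = two_roots_sums_vanish[OF this, of d]
  have dr: "degree (reflect_poly f) \<le> d" using degree_reflect_poly_le[of f] deg by simp
  have rev: "(\<Sum>m\<le>d. g m * coeff (reflect_poly f) m) = (\<Sum>m\<le>d. g (d - m) * v m)"
    for g :: "nat \<Rightarrow> complex"
    by (rule sum.reindex_bij_witness[of _ "\<lambda>m. d - m" "\<lambda>m. d - m"])
       (auto simp: coeff_reflect_poly deg co)
  have i0: "(\<Sum>m\<le>d. inverse z ^ (d - m) * v m) = 0"
    "(\<Sum>m\<le>d. divdiff (d - m) (inverse z) (inverse w) * v m) = 0"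
    using *[OF dr] unfolding rev by auto
  show "\<bar>inverse (cmod z) - inverse (cmod w)\<bar> > 1 / N"
    using close_pairI[OF v _ _ _ i0] v' zw(3,4) not_le unfolding norm_inverse by blast
qed

text \<open>If x \<le> 2, a gap 1/N is at least y/(2N). If 1/y \<le> 2, multiplying the gap of the
  inverses by x y gives the same, now using x > 2. Otherwise y < 1/2 and x > 2, and the ratio is
  large anyway.\<close>

lemma modulus_ratio_of_gaps:
  fixes x y :: real
  assumes "0 < y" "y \<le> x" and N: "N \<ge> (1::nat)"
    and "x \<le> 2 \<Longrightarrow> x - y > 1 / real N"
    and "inverse y \<le> 2 \<Longrightarrow> inverse y - inverse x > 1 / real N"
  shows "(1 + 1 / (2 * real N)) * y \<le> x"
proof (cases "x \<le> 2")
  case True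
  have "y / (2 * real N) \<le> 2 / (2 * real N)" using True assms by (intro divide_right_mono) auto
  then have "y / (2 * real N) \<le> 1 / real N" by simp
  with assms(4)[OF True] show ?thesis by (simp add: algebra_simps)
next
  case False
  show ?thesis
  proof (cases "inverse y \<le> 2")
    case True
    have "1 / real N * (x * y) < (inverse y - inverse x) * (x * y)"
      using assms False by (intro mult_strict_right_mono assms(5)[OF True]) auto
    also have "\<dots> = x - y" using assms by (simp add: field_simps)
    finally have "1 / real N * (x * y) < x - y" .
    moreover have "1 / (2 * real N) * (1 * y) \<le> 1 / real N * (x * y)"
      using False assms by (intro mult_mono) (auto simp: field_simps)
    ultimately show ?thesis by (simp add: algebra_simps)
  next
    case y: False
    then have "y < 1 / 2" using assms(1) by (simp add: field_simps)
    have "(1 + 1 / (2 * real N)) * y \<le> 2 * y"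
      using assms by (intro mult_right_mono) (auto simp: field_simps)
    then show ?thesis using \<open>y < 1 / 2\<close> False by linarith
  qed
qed

text \<open>Converts absolute into relative error. The factor 2 is lost above 1, where ln x \<ge> 1
  - 1/x yields only 1/(N + 1).\<close>

lemma abs_ln_ge_of_gap:
  fixes x :: real
  assumes "x > 0" "N \<ge> (1::nat)" "\<bar>x - 1\<bar> > 1 / real N"
  shows "\<bar>ln x\<bar> \<ge> 1 / (2 * real N)"
proof (cases "x > 1")
  case True
  have x: "x \<ge> 1 + 1 / real N" using True assms by auto
  have "ln (inverse x) \<le> inverse x - 1" using assms by (intro ln_le_minus_one) auto
  then have "1 - inverse x \<le> ln x" using assms by (simp add: ln_inverse)
  moreover have "inverse x \<le> inverse (1 + 1 / real N)"
    using x by (intro le_imp_inverse_le) (auto intro: add_pos_nonneg)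
  moreover have "inverse (1 + 1 / real N) = 1 - 1 / (real N + 1)" using assms by (simp add: field_simps)
  moreover have "1 / (2 * real N) \<le> 1 / (real N + 1)" using assms by (intro divide_left_mono) auto
  ultimately show ?thesis by (simp add: add.commute)
next
  case False
  have "ln x \<le> x - 1" using assms by (intro ln_le_minus_one) auto
  moreover have "1 / (2 * real N) \<le> 1 / real N" using assms by (intro divide_left_mono) auto
  ultimately show ?thesis using False assms(3) by simp
qed

text \<open>By Bernoulli each block of 2N factors is worth at least 2, and K contains M such
  blocks.\<close>

lemma power_ratio_ge:
  assumes "N \<ge> (1::nat)" "2 * N * M \<le> K"
  shows "(1 + 1 / (2 * real N)) ^ K \<ge> 2 ^ M"
proof -
  have "2 = 1 + real (2 * N) * (1 / (2 * real N))" using assms by simp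
  also have "\<dots> \<le> (1 + 1 / (2 * real N)) ^ (2 * N)"
    by (rule Bernoulli_inequality) (auto intro: order_trans[of _ 0])
  finally have "(2::real) ^ M \<le> ((1 + 1 / (2 * real N)) ^ (2 * N)) ^ M"
    by (intro power_mono) auto
  also have "\<dots> \<le> (1 + 1 / (2 * real N)) ^ K"
    unfolding power_mult[symmetric] using assms(2) by (intro power_increasing) auto
  finally show ?thesis .
qed

lemma graeffe_succeeds_off_exceptional:
  assumes d: "d \<ge> 1" and N: "N \<ge> 1" and b: "b \<ge> 0"
    and v: "v \<in> polydisc {..d}" "v 0 \<noteq> 0" "v d \<noteq> 0"
    and c1: "v \<notin> close_pair (\<lambda>m. m) d N" and c2: "v \<notin> close_pair (\<lambda>m. d - m) d N"
    and nc: "v \<notin> near_circle d N"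
    and k: "2 * N * (d + 3 + N + nat \<lceil>b\<rceil>) \<le> 2 ^ k"
  shows "graeffe_succeeds k b (poly_of_coeffs d v)"
proof -
  define f where "f = poly_of_coeffs d v"
  define q where "q = 1 + 1 / (2 * real N)"
  have deg: "degree f = d" using v d by (simp add: f_def degree_poly_of_coeffs_eq_iff)
  with d have f0: "f \<noteq> 0" by auto
  have q1: "q \<ge> 1" by (simp add: q_def)
  \<comment> \<open>The exponent collects what the error estimate consumes: 2^d from the
    coefficients, 2^3 from its 4 and the 2 in 1/(2N), N \<le> 2^N from the distance to the unit
    circle, and 2^b from the precision.\<close>
  have "2 ^ (d + 3 + N + nat \<lceil>b\<rceil>) \<le> q ^ 2 ^ k"
    unfolding q_def by (rule power_ratio_ge[OF N k])
  moreover have "(8::real) * 2 ^ d * real N * 2 powr b \<le> 8 * 2 ^ d * 2 ^ N * 2 ^ nat \<lceil>b\<rceil>"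
  proof (intro mult_mono)
    have "2 powr b \<le> 2 powr real (nat \<lceil>b\<rceil>)"
      by (intro powr_mono real_nat_ceiling_ge) auto
    then show "2 powr b \<le> 2 ^ nat \<lceil>b\<rceil>" by (simp add: powr_realpow)
    show "real N \<le> 2 ^ N" by (rule less_imp_le[OF of_nat_less_two_power])
  qed auto
  moreover have "8 * 2 ^ d * 2 ^ N * 2 ^ nat \<lceil>b\<rceil> = (2::real) ^ (d + 3 + N + nat \<lceil>b\<rceil>)"
    by (simp add: power_add)
  ultimately have qk: "8 * 2 ^ d * real N * 2 powr b \<le> q ^ 2 ^ k" by linarith
  have "1 \<le> 2 powr b" using b by (simp add: ge_one_powr_ge_zero)
  then have "1 * 1 \<le> real N * 2 powr b" using N by (intro mult_mono) auto
  then have "2 * 2 ^ d * 1 \<le> (8 * 2 ^ d) * (real N * 2 powr b)" by (intro mult_mono) auto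
  also have "\<dots> = 8 * 2 ^ d * real N * 2 powr b" by simp
  also note qk
  finally have big: "2 * 2 ^ degree f \<le> q ^ 2 ^ k" by (simp add: deg)
  \<comment> \<open>The gain 1/2^k from renormalization is discarded; the decay of 1 / q^(2^k)
    suffices.\<close>
  have err: "4 * 2 ^ d / q ^ 2 ^ k / 2 ^ k \<le> 2 powr (- b) * (1 / (2 * real N))"
  proof -
    have "4 * 2 ^ d / q ^ 2 ^ k / 2 ^ k \<le> 4 * 2 ^ d / q ^ 2 ^ k / 1"
      using q1 by (intro divide_left_mono) auto
    also have "\<dots> \<le> 4 * 2 ^ d / (8 * 2 ^ d * real N * 2 powr b) / 1"
      using qk N q1 by (intro divide_left_mono divide_right_mono) auto
    also have "\<dots> = 2 powr (- b) * (1 / (2 * real N))"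
      by (simp add: powr_minus field_simps)
    finally show ?thesis .
  qed
  have main: "(j \<le> d \<longrightarrow> coeff ((graeffe ^^ k) f) j \<noteq> 0) \<and>
      (j < d \<longrightarrow> approximates_rel b (graeffe_log_root k f j) (ln (cmod (\<zeta> (d - j)))))"
    if rd: "roots_decreasing f \<zeta>" for \<zeta> j
  proof -
    have fac: "f = smult (lead_coeff f) (\<Prod>i\<in>{1..d}. [:- \<zeta> i, 1:])"
      using roots_decreasing_factor[OF rd] by (simp add: deg)
    have root: "poly f (\<zeta> i) = 0" if "1 \<le> i" "i \<le> d" for i
      by (subst fac) (use that in \<open>auto simp: poly_prod\<close>)
    have nz: "\<zeta> i \<noteq> 0" if "1 \<le> i" "i \<le> d" for i
    proof
      assume "\<zeta> i = 0"
      with root[OF that] have "coeff f 0 = 0" by (simp add: poly_0_coeff_0)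
      then show False using v(2) by (simp add: f_def coeff_poly_of_coeffs)
    qed
    have sep: "q * cmod (\<zeta> j) \<le> cmod (\<zeta> i)" if ij: "1 \<le> i" "i < j" "j \<le> d" for i j
    proof -
      \<comment> \<open>The factors are removed by index, so this also covers \<zeta> i = \<zeta>
        j.\<close>
      have "(\<Prod>i\<in>{1..d}. [:- \<zeta> i, 1:]) =
          [:- \<zeta> i, 1:] * ([:- \<zeta> j, 1:] * (\<Prod>i\<in>{1..d} - {i} - {j}. [:- \<zeta> i, 1:]))"
        using ij by (subst prod.remove[of _ i], simp, simp, subst prod.remove[of _ j]) auto
      then have pf: "f = [:- \<zeta> i, 1:] * ([:- \<zeta> j, 1:] *
          smult (lead_coeff f) (\<Prod>i\<in>{1..d} - {i} - {j}. [:- \<zeta> i, 1:]))"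
        using fac by (simp only: mult_smult_right)
      have "antimono_on {1..d} (\<lambda>i. cmod (\<zeta> i))"
        using rd by (simp add: roots_decreasing_def deg)
      from monotone_onD[OF this, of i j] have le: "cmod (\<zeta> j) \<le> cmod (\<zeta> i)"
        using ij by simp
      have zi: "\<zeta> i \<noteq> 0" and zj: "\<zeta> j \<noteq> 0" using nz ij by auto
      have inv: "inverse (cmod (\<zeta> i)) \<le> inverse (cmod (\<zeta> j))"
        using le zj by (intro le_imp_inverse_le) auto
      note tr = two_roots_close_pair[OF v(1,3) d pf[unfolded f_def], of N]
      show ?thesis unfolding q_def
      proof (rule modulus_ratio_of_gaps[OF _ le N])
        show "cmod (\<zeta> i) - cmod (\<zeta> j) > 1 / real N" if "cmod (\<zeta> i) \<le> 2"
          using tr(1)[OF c1] that le by linarith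
        show "inverse (cmod (\<zeta> j)) - inverse (cmod (\<zeta> i)) > 1 / real N" if "inverse (cmod (\<zeta> j)) \<le> 2"
          using tr(2)[OF c2 zj zi that] that inv by linarith
      qed (use zj in auto)
    qed
    note er = graeffe_log_root_error[OF rd nz[folded deg] f0 sep[folded deg] q1 big, of j]
    have "approximates_rel b (graeffe_log_root k f j) (ln (cmod (\<zeta> (d - j))))" if j: "j < d"
    proof -
      have ij: "1 \<le> d - j" "d - j \<le> d" using j by auto
      have "(\<Sum>m\<le>d. \<zeta> (d - j) ^ m * v m) = poly f (\<zeta> (d - j))"
        by (simp add: f_def poly_of_coeffs_def poly_sum poly_monom mult.commute)
      then have "\<not> \<bar>cmod (\<zeta> (d - j)) - 1\<bar> \<le> 1 / real N"
        using nc v(1) root[OF ij] by (auto simp: near_circle_def)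
      then have "1 / (2 * real N) \<le> \<bar>ln (cmod (\<zeta> (d - j)))\<bar>"
        using nz[OF ij] N by (intro abs_ln_ge_of_gap) auto
      then have "2 powr (- b) * (1 / (2 * real N)) \<le> 2 powr (- b) * \<bar>ln (cmod (\<zeta> (d - j)))\<bar>"
        by (intro mult_left_mono) auto
      with er(2) err j show ?thesis
        unfolding approximates_rel_def deg by linarith
    qed
    with er(1) show ?thesis by (auto simp: deg)
  qed
  obtain \<zeta> where "roots_decreasing f \<zeta>" using roots_decreasing_exists by blast
  then show ?thesis
    unfolding f_def[symmetric] graeffe_succeeds_def deg using main by blast
qed

section \<open>Transfer to admissible distributions\<close>

lemma emeasure_coeff_space:
  assumes "A \<subseteq> coeff_vectors d"
  shows "emeasure (coeff_space d) A = emeasure (leb {..d}) A"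
  unfolding coeff_space_def using assms coeff_vectors_measurable
  by (intro emeasure_restrict_space) (auto simp: Int_absorb2 sets.Int_space_eq2)

lemma unit_ball_subset_polydisc: "unit_ball d \<subseteq> polydisc {..d}"
proof
  fix v assume v: "v \<in> unit_ball d"
  have "cmod (v i) \<le> 1" if "i \<le> d" for i
  proof -
    have "(cmod (v i))\<^sup>2 \<le> (\<Sum>i\<le>d. (cmod (v i))\<^sup>2)"
      using that by (intro member_le_sum) auto
    also have "\<dots> \<le> 1" using v by (simp add: unit_ball_def)
    finally show ?thesis by (simp add: power_le_one_iff abs_square_le_1)
  qed
  then show "v \<in> polydisc {..d}"
    using v by (auto simp: unit_ball_def coeff_vectors_def PiE_def polydisc_def)
qed

lemma failure_volume_bound:
  assumes d: "d \<ge> 1"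
  shows "\<exists>K>0. \<forall>N k b. N \<ge> 1 \<longrightarrow> b \<ge> 0 \<longrightarrow> 2 * N * (d + 3 + N + nat \<lceil>b\<rceil>) \<le> 2 ^ k \<longrightarrow>
    emeasure (coeff_space d) (unit_ball d - success_set d k b) \<le> ennreal (K / real N)"
proof -
  define K1 where "K1 = 192 * (pi ^ (d - 1) * (16 * pi * (perturb_bound d)\<^sup>2)\<^sup>2)"
  define K2 where "K2 = 8 * (pi ^ d * (4 * pi * (perturb_bound d)\<^sup>2))"
  have K: "K1 \<ge> 0" "K2 \<ge> 0" by (simp_all add: K1_def K2_def)
  \<comment> \<open>K1 counts twice, for the polynomial and for its reversal; the summand 1 makes
    the constant positive.\<close>
  have "emeasure (coeff_space d) (unit_ball d - success_set d k b) \<le> ennreal ((2 * K1 + K2 + 1) / real N)"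
    if N: "N \<ge> 1" and b: "b \<ge> 0" and k: "2 * N * (d + 3 + N + nat \<lceil>b\<rceil>) \<le> 2 ^ k" for N k b
  proof -
    obtain U1 where U1 [measurable]: "U1 \<in> sets (leb {..d})" and "close_pair (\<lambda>m. m) d N \<subseteq> U1"
      "emeasure (leb {..d}) U1 \<le> ennreal (K1 / N)"
      using close_pair_cover[OF d N, of "\<lambda>m. m" 0 1] d by (auto simp: K1_def)
    obtain U2 where U2 [measurable]: "U2 \<in> sets (leb {..d})" and "close_pair (\<lambda>m. d - m) d N \<subseteq> U2"
      "emeasure (leb {..d}) U2 \<le> ennreal (K1 / N)"
      using close_pair_cover[OF d N, of "\<lambda>m. d - m" d "d - 1"] d by (auto simp: K1_def)
    obtain U3 where U3 [measurable]: "U3 \<in> sets (leb {..d})" and "near_circle d N \<subseteq> U3"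
      "emeasure (leb {..d}) U3 \<le> ennreal (K2 / N)"
      using near_circle_cover[OF d N] by (auto simp: K2_def)
    define Z where "Z = {v \<in> polydisc {..d}. v 0 = 0} \<union> {v \<in> polydisc {..d}. v d = 0}"
    have Z: "Z \<in> null_sets (leb {..d})"
      unfolding Z_def by (intro null_sets.Un coordinate_zero_null) auto
    then have [measurable]: "Z \<in> sets (leb {..d})" by blast
    have "unit_ball d - success_set d k b \<subseteq> (U1 \<union> U2 \<union> U3) \<union> Z"
    proof
      fix v assume v: "v \<in> unit_ball d - success_set d k b"
      then have vp: "v \<in> polydisc {..d}" and "v \<in> coeff_vectors d"
        using unit_ball_subset_polydisc by (auto simp: unit_ball_def)
      show "v \<in> (U1 \<union> U2 \<union> U3) \<union> Z"
      proof (rule ccontr)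
        assume "v \<notin> (U1 \<union> U2 \<union> U3) \<union> Z"
        then have "v 0 \<noteq> 0" "v d \<noteq> 0" "v \<notin> close_pair (\<lambda>m. m) d N" "v \<notin> close_pair (\<lambda>m. d - m) d N"
          "v \<notin> near_circle d N"
          using vp \<open>close_pair (\<lambda>m. m) d N \<subseteq> U1\<close> \<open>close_pair (\<lambda>m. d - m) d N \<subseteq> U2\<close>
            \<open>near_circle d N \<subseteq> U3\<close> by (auto simp: Z_def)
        with graeffe_succeeds_off_exceptional[OF d N b vp _ _ _ _ _ k] v \<open>v \<in> coeff_vectors d\<close> d
        show False by (auto simp: success_set_def degree_poly_of_coeffs_eq_iff)
      qed
    qed
    then have "emeasure (leb {..d}) (unit_ball d - success_set d k b) \<le>
        emeasure (leb {..d}) ((U1 \<union> U2 \<union> U3) \<union> Z)"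
      by (intro emeasure_mono) auto
    also have "\<dots> = emeasure (leb {..d}) (U1 \<union> U2 \<union> U3)"
      by (rule emeasure_Un_null_set) (use Z in auto)
    also have "\<dots> \<le> emeasure (leb {..d}) U1 + emeasure (leb {..d}) U2 + emeasure (leb {..d}) U3"
      by (intro order_trans[OF emeasure_subadditive] add_right_mono emeasure_subadditive) auto
    also have "\<dots> \<le> ennreal (K1 / N) + ennreal (K1 / N) + ennreal (K2 / N)"
      by (intro add_mono) fact+
    also have "\<dots> = ennreal ((2 * K1 + K2) / N)"
      using K by (simp add: ennreal_plus[symmetric] add_divide_distrib del: ennreal_plus)
    also have "\<dots> \<le> ennreal ((2 * K1 + K2 + 1) / real N)"
      by (intro ennreal_leI divide_right_mono) auto
    also have "emeasure (leb {..d}) (unit_ball d - success_set d k b) =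
        emeasure (coeff_space d) (unit_ball d - success_set d k b)"
      by (rule emeasure_coeff_space[symmetric]) (auto simp: unit_ball_def)
    finally show ?thesis .
  qed
  then show ?thesis using K by (intro exI[of _ "2 * K1 + K2 + 1"]) auto
qed

section \<open>Scaling-invariant sets and their projective images\<close>

definition scale_coeffs :: "nat \<Rightarrow> complex \<Rightarrow> (nat \<Rightarrow> complex) \<Rightarrow> nat \<Rightarrow> complex" where
  "scale_coeffs d c v = (\<lambda>i\<in>{..d}. c * v i)"

lemma poly_of_coeffs_scale: "poly_of_coeffs d (scale_coeffs d c v) = smult c (poly_of_coeffs d v)"
  by (intro poly_eqI) (simp add: coeff_poly_of_coeffs scale_coeffs_def)

lemma scale_in_success_set_iff:
  assumes "c \<noteq> 0" "v \<in> coeff_vectors d"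
  shows "scale_coeffs d c v \<in> success_set d k b \<longleftrightarrow> v \<in> success_set d k b"
proof -
  obtain i where i: "i \<le> d" "v i \<noteq> 0" using assms by (auto simp: coeff_vectors_def)
  then have "coeff (poly_of_coeffs d v) i \<noteq> 0" by (simp add: coeff_poly_of_coeffs)
  then have "poly_of_coeffs d v \<noteq> 0" by auto
  moreover have "scale_coeffs d c v \<in> coeff_vectors d"
    using i assms by (auto simp: coeff_vectors_def scale_coeffs_def)
  ultimately show ?thesis
    using assms by (simp add: success_set_def poly_of_coeffs_scale graeffe_succeeds_smult)
qed

lemma proj_class_saturated:
  assumes F: "F \<subseteq> coeff_vectors d"
    and inv: "\<And>c v. c \<noteq> 0 \<Longrightarrow> v \<in> F \<Longrightarrow> scale_coeffs d c v \<in> F"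
  shows "proj_class d -` (proj_class d ` F) \<inter> coeff_vectors d = F"
proof (intro equalityI subsetI)
  fix w assume "w \<in> proj_class d -` (proj_class d ` F) \<inter> coeff_vectors d"
  then obtain v where v: "v \<in> F" "proj_class d w = proj_class d v" and w: "w \<in> coeff_vectors d"
    by auto
  have "w = (\<lambda>i\<in>{..d}. 1 * w i)"
    using w by (auto simp: coeff_vectors_def extensional_def fun_eq_iff)
  then have "w \<in> proj_class d w" unfolding proj_class_def mem_Collect_eq
    by (intro exI[of _ 1]) simp
  then obtain c where "c \<noteq> 0" "w = scale_coeffs d c v"
    unfolding v(2) by (auto simp: proj_class_def scale_coeffs_def)
  then show "w \<in> F" using inv v by simp
qed (use F in auto)

text \<open>A scaling-invariant set is the full preimage of its image, so the image is measurable in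
  the quotient and projectivizing preserves its measure.\<close>

lemma emeasure_projectivize_saturated:
  assumes M: "sets M = sets (coeff_space d)" and F: "F \<in> sets (coeff_space d)"
    and inv: "\<And>c v. c \<noteq> 0 \<Longrightarrow> v \<in> F \<Longrightarrow> scale_coeffs d c v \<in> F"
  shows "proj_class d ` F \<in> sets (proj_space d)"
    and "emeasure (projectivize d M) (proj_class d ` F) = emeasure M F"
proof -
  have Fs: "F \<subseteq> coeff_vectors d" using sets.sets_into_space[OF F] by simp
  note sat = proj_class_saturated[OF Fs inv]
  have "proj_class d ` F \<in> {A. A \<subseteq> proj_class d ` coeff_vectors d \<and>
         proj_class d -` A \<inter> coeff_vectors d \<in> sets (coeff_space d)}"
    using Fs F sat by auto
  then show A: "proj_class d ` F \<in> sets (proj_space d)"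
    unfolding proj_space_def by (rule in_measure_of[rotated]) auto
  have "space M = coeff_vectors d" using sets_eq_imp_space_eq[OF M] by simp
  moreover have "proj_class d \<in> M \<rightarrow>\<^sub>M proj_space d"
    using proj_class_measurable measurable_cong_sets[OF M refl] by blast
  ultimately show "emeasure (projectivize d M) (proj_class d ` F) = emeasure M F"
    unfolding projectivize_def using A sat by (subst emeasure_distr) auto
qed

text \<open>The total mass of the uniform measure is V / V, and in \<open>ennreal\<close> this
  equals 1 only if V is neither 0 nor infinite; so the known total mass of
  \<open>uniform_proj\<close> yields both facts.\<close>

lemma unit_ball_volume_cases:
  obtains V where "V > 0" "emeasure (coeff_space d) (unit_ball d) = ennreal V"
proof -
  let ?U = "uniform_measure (coeff_space d) (unit_ball d)"
  let ?e = "emeasure (coeff_space d) (unit_ball d)"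
  interpret prob_space "uniform_proj d" by (rule prob_space_uniform_proj)
  have "proj_class d ` coeff_vectors d = space (uniform_proj d)"
    by (simp add: uniform_proj_def projectivize_def space_proj_space)
  moreover have "emeasure (projectivize d ?U) (proj_class d ` coeff_vectors d) = emeasure ?U (coeff_vectors d)"
  proof (rule emeasure_projectivize_saturated)
    show "coeff_vectors d \<in> sets (coeff_space d)"
      by (metis sets.top space_coeff_space)
  qed (auto simp: coeff_vectors_def scale_coeffs_def)
  ultimately have "emeasure ?U (coeff_vectors d) = 1"
    using emeasure_space_1 by (simp add: uniform_proj_def)
  moreover have "coeff_vectors d \<in> sets (coeff_space d)" by (metis sets.top space_coeff_space)
  moreover have "unit_ball d \<inter> coeff_vectors d = unit_ball d" by (auto simp: unit_ball_def)
  ultimately have "?e / ?e = 1" by simp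
  then have "?e \<noteq> 0" "?e \<noteq> \<infinity>" by auto
  then show ?thesis using that[of "enn2real ?e"]
    by (metis enn2real_positive_iff ennreal_enn2real infinity_ennreal_def top.not_eq_extremum zero_less_iff_neq_zero)
qed

text \<open>On scaling-invariant sets the bounded density compares M with the volume inside the unit
  ball, because \<open>uniform_proj\<close> is the image of the normalized volume of that ball. This
  normalization puts V in the constant C / V.\<close>

lemma admissible_emeasure_bound:
  assumes adm: "admissible d M"
  shows "\<exists>C>0. \<forall>F\<in>sets (coeff_space d). (\<forall>c v. c \<noteq> 0 \<longrightarrow> v \<in> F \<longrightarrow> scale_coeffs d c v \<in> F) \<longrightarrow>
    emeasure M F \<le> ennreal C * emeasure (coeff_space d) (unit_ball d \<inter> F)"
proof -
  let ?U = "uniform_proj d"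
  let ?P = "projectivize d M"
  interpret U: prob_space ?U by (rule prob_space_uniform_proj)
  have M: "sets M = sets (coeff_space d)" and ac: "absolutely_continuous ?U ?P"
    using adm by (auto simp: admissible_def)
  obtain C0 :: real where C0: "AE L in ?U. RN_deriv ?U ?P L \<le> ennreal C0"
    using adm by (auto simp: admissible_def)
  define C where "C = max C0 1"
  have C: "AE L in ?U. RN_deriv ?U ?P L \<le> ennreal C"
    using C0 by eventually_elim (auto simp: C_def intro: order_trans ennreal_leI)
  have sP: "sets ?P = sets ?U" by (simp add: uniform_proj_def projectivize_def)
  have sU: "sets ?U = sets (proj_space d)" by (simp add: uniform_proj_def projectivize_def)
  obtain V where V: "V > 0" "emeasure (coeff_space d) (unit_ball d) = ennreal V"
    by (rule unit_ball_volume_cases)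
  have "emeasure M F \<le> ennreal (C / V) * emeasure (coeff_space d) (unit_ball d \<inter> F)"
    if F: "F \<in> sets (coeff_space d)" and inv: "\<forall>c v. c \<noteq> 0 \<longrightarrow> v \<in> F \<longrightarrow> scale_coeffs d c v \<in> F" for F
  proof -
    let ?A = "proj_class d ` F"
    have A: "?A \<in> sets ?U" unfolding sU
      by (rule emeasure_projectivize_saturated(1)[OF M F]) (use inv in auto)
    have "emeasure M F = emeasure ?P ?A"
      by (rule emeasure_projectivize_saturated(2)[OF M F, symmetric]) (use inv in auto)
    also have "\<dots> = emeasure (density ?U (RN_deriv ?U ?P)) ?A"
      by (simp add: U.density_RN_deriv[OF ac sP])
    also have "\<dots> = (\<integral>\<^sup>+L. RN_deriv ?U ?P L * indicator ?A L \<partial>?U)"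
      using A by (intro emeasure_density) auto
    also have "\<dots> \<le> (\<integral>\<^sup>+L. ennreal C * indicator ?A L \<partial>?U)"
      using C by (intro nn_integral_mono_AE) (elim eventually_mono, rule mult_right_mono, auto)
    also have "\<dots> = ennreal C * emeasure ?U ?A"
      using A by (simp add: nn_integral_cmult)
    also have "emeasure ?U ?A = emeasure (uniform_measure (coeff_space d) (unit_ball d)) F"
      unfolding uniform_proj_def
      by (rule emeasure_projectivize_saturated(2)[OF _ F]) (use inv in auto)
    also have "\<dots> = emeasure (coeff_space d) (unit_ball d \<inter> F) / ennreal V"
      using F by (simp add: V)
    also have "ennreal C * (emeasure (coeff_space d) (unit_ball d \<inter> F) / ennreal V) =
        ennreal (C / V) * emeasure (coeff_space d) (unit_ball d \<inter> F)"
      using V(1) by (simp add: C_def divide_ennreal_def inverse_ennreal divide_inverse ennreal_mult' mult_ac)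
    finally show ?thesis .
  qed
  then show ?thesis using V(1) by (intro exI[of _ "C / V"]) (auto simp: C_def)
qed

lemma admissible_success_probability:
  assumes d: "d \<ge> 1" and adm: "admissible d M"
  shows "\<exists>K>0. \<forall>N k b. N \<ge> 1 \<longrightarrow> b \<ge> 0 \<longrightarrow> 2 * N * (d + 3 + N + nat \<lceil>b\<rceil>) \<le> 2 ^ k \<longrightarrow>
    measure M (success_set d k b) \<ge> 1 - K / real N"
proof -
  have M: "sets M = sets (coeff_space d)" and "prob_space M" using adm by (auto simp: admissible_def)
  interpret prob_space M by fact
  have sp: "space M = coeff_vectors d" using sets_eq_imp_space_eq[OF M] by simp
  obtain K where K: "K > 0" "\<And>N k b. N \<ge> 1 \<Longrightarrow> b \<ge> 0 \<Longrightarrow> 2 * N * (d + 3 + N + nat \<lceil>b\<rceil>) \<le> 2 ^ k \<Longrightarrow>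
    emeasure (coeff_space d) (unit_ball d - success_set d k b) \<le> ennreal (K / real N)"
    using failure_volume_bound[OF d] by blast
  obtain C where C: "C > 0" "\<And>F. F \<in> sets (coeff_space d) \<Longrightarrow>
    (\<And>c v. c \<noteq> 0 \<Longrightarrow> v \<in> F \<Longrightarrow> scale_coeffs d c v \<in> F) \<Longrightarrow>
    emeasure M F \<le> ennreal C * emeasure (coeff_space d) (unit_ball d \<inter> F)"
    using admissible_emeasure_bound[OF adm] by metis
  have "measure M (success_set d k b) \<ge> 1 - C * K / real N"
    if N: "N \<ge> 1" and b: "b \<ge> 0" and k: "2 * N * (d + 3 + N + nat \<lceil>b\<rceil>) \<le> 2 ^ k" for N k b
  proof -
    \<comment> \<open>F also contains the vectors of lower degree; being scaling-invariant, it can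
      be measured through the projectivization.\<close>
    define F where "F = coeff_vectors d - success_set d k b"
    have S: "success_set d k b \<in> sets M" using success_set_measurable[OF d] M by simp
    have F: "F \<in> sets (coeff_space d)"
      using S M sp sets.compl_sets[OF S] by (simp add: F_def)
    have "scale_coeffs d c v \<in> F" if "c \<noteq> 0" "v \<in> F" for c v
    proof -
      have "v \<in> coeff_vectors d" using that by (simp add: F_def)
      moreover from this have "scale_coeffs d c v \<in> coeff_vectors d"
        using that(1) by (auto simp: coeff_vectors_def scale_coeffs_def)
      ultimately show ?thesis using that scale_in_success_set_iff[OF that(1), of v d k b] by (simp add: F_def)
    qed
    from C(2)[OF F this] have "emeasure M F \<le> ennreal C * emeasure (coeff_space d) (unit_ball d \<inter> F)" .
    also have "unit_ball d \<inter> F = unit_ball d - success_set d k b"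
      by (auto simp: F_def unit_ball_def)
    also have "ennreal C * emeasure (coeff_space d) \<dots> \<le> ennreal C * ennreal (K / N)"
      by (intro mult_left_mono K(2) N b k) auto
    also have "\<dots> = ennreal (C * K / N)" using C(1) K(1) by (simp add: ennreal_mult'[symmetric])
    finally have "measure M F \<le> C * K / N"
      using C(1) K(1) by (simp add: emeasure_eq_measure)
    moreover have "measure M F = 1 - measure M (success_set d k b)"
      using prob_compl[OF S] by (simp add: F_def sp)
    ultimately show ?thesis by simp
  qed
  then show ?thesis using C(1) K(1) by (intro exI[of _ "C * K"]) auto
qed

text \<open>As N, b \<ge> 1, each summand is at most a multiple of N b, where the rounded b costs 2
  N b; together they give (d + 6) N b. The outer factor 2N makes the total quadratic in N and linear
  in b, whence the coefficients 2 of log \<delta> and 1 of log b.\<close>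

lemma iteration_count_suffices:
  assumes "N \<ge> 1" "b \<ge> 1" and N: "real N \<le> L / \<delta>" and "\<delta> > 0" "L > 0"
    and k: "real k \<ge> (log 2 (2 * (real d + 6)) + 2 * log 2 L) + 1 * log 2 b - 2 * log 2 \<delta>"
  shows "2 * N * (d + 3 + N + nat \<lceil>b\<rceil>) \<le> 2 ^ k"
proof -
  have "real (nat \<lceil>b\<rceil>) \<le> b + 1" using assms(2) by linarith
  moreover have "b \<le> N * b" using mult_right_mono[of 1 "real N" b] assms(1,2) by simp
  ultimately have c: "real (nat \<lceil>b\<rceil>) \<le> 2 * (N * b)" using assms(2) by linarith
  have Nb: "1 \<le> N * b" "real N \<le> N * b"
    using mult_mono[of 1 "real N" 1 b] mult_left_mono[of 1 b "real N"] assms by simp_all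
  have "real (d + 3 + N + nat \<lceil>b\<rceil>) \<le> d * (N * b) + 3 * (N * b) + (N * b) + 2 * (N * b)"
    using c Nb mult_left_mono[OF Nb(1), of "real d"] by linarith
  also have "\<dots> = (real d + 6) * (N * b)" by (simp add: algebra_simps)
  finally have "2 * real N * real (d + 3 + N + nat \<lceil>b\<rceil>) \<le> 2 * real N * ((real d + 6) * (N * b))"
    by (intro mult_left_mono) auto
  also have "\<dots> = 2 * (real d + 6) * b * (real N)\<^sup>2" by (simp add: power2_eq_square)
  also have "\<dots> \<le> 2 * (real d + 6) * b * (L / \<delta>)\<^sup>2"
    using N assms by (intro mult_left_mono power_mono) auto
  also have "\<dots> = 2 powr (log 2 (2 * (real d + 6) * b * (L / \<delta>)\<^sup>2))"
    using assms by (intro powr_log_cancel[symmetric]) auto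
  also have "log 2 (2 * (real d + 6) * b * (L / \<delta>)\<^sup>2) =
      (log 2 (2 * (real d + 6)) + 2 * log 2 L) + 1 * log 2 b - 2 * log 2 \<delta>"
    using assms by (simp add: log_mult_pos log_nat_power log_divide_pos)
  also have "2 powr \<dots> \<le> 2 powr real k" using k by (intro powr_mono) auto
  also have "\<dots> = real (2 ^ k)" by (simp add: powr_realpow)
  finally have "real (2 * N * (d + 3 + N + nat \<lceil>b\<rceil>)) \<le> real (2 ^ k)" by simp
  then show ?thesis by (simp only: of_nat_le_iff)
qed

theorem theorem2:
  shows "\<exists>c\<^sub>2 c\<^sub>3 :: real. \<forall>(d::nat) (M :: (nat \<Rightarrow> complex) measure).
    d \<ge> 1 \<longrightarrow> admissible d M \<longrightarrow>
    (\<exists>c\<^sub>1 :: real. \<forall>(b::real) (\<delta>::real) (k::nat).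
       b \<ge> 1 + log 2 (real d) \<longrightarrow> 0 < \<delta> \<longrightarrow> \<delta> < 1 \<longrightarrow>
       real k \<ge> c\<^sub>1 + c\<^sub>2 * log 2 b - c\<^sub>3 * log 2 \<delta> \<longrightarrow>
       \<P>(v in M. degree (poly_of_coeffs d v) = d \<and> graeffe_succeeds k b (poly_of_coeffs d v)) \<ge> 1 - \<delta>)"
proof (rule exI[of _ 1], rule exI[of _ 2], intro allI impI)
  fix d :: nat and M :: "(nat \<Rightarrow> complex) measure"
  assume d: "d \<ge> 1" and adm: "admissible d M"
  have sp: "space M = coeff_vectors d"
    using adm sets_eq_imp_space_eq[of M "coeff_space d"] by (simp add: admissible_def)
  obtain K where K: "K > 0" "\<And>N k b. N \<ge> 1 \<Longrightarrow> b \<ge> 0 \<Longrightarrow> 2 * N * (d + 3 + N + nat \<lceil>b\<rceil>) \<le> 2 ^ k \<Longrightarrow>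
    measure M (success_set d k b) \<ge> 1 - K / real N"
    using admissible_success_probability[OF d adm] by blast
  show "\<exists>c\<^sub>1 :: real. \<forall>(b::real) (\<delta>::real) (k::nat).
       b \<ge> 1 + log 2 (real d) \<longrightarrow> 0 < \<delta> \<longrightarrow> \<delta> < 1 \<longrightarrow>
       real k \<ge> c\<^sub>1 + 1 * log 2 b - 2 * log 2 \<delta> \<longrightarrow>
       \<P>(v in M. degree (poly_of_coeffs d v) = d \<and> graeffe_succeeds k b (poly_of_coeffs d v)) \<ge> 1 - \<delta>"
  \<comment> \<open>K + 1 instead of K pays for rounding N up: K/\<delta> + 1 \<le> (K + 1)/\<delta>
    because \<delta> < 1.\<close>
  proof (rule exI[of _ "log 2 (2 * (real d + 6)) + 2 * log 2 (K + 1)"], intro allI impI)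
    fix b \<delta> :: real and k :: nat
    assume b: "b \<ge> 1 + log 2 (real d)" and \<delta>: "0 < \<delta>" "\<delta> < 1"
      and k: "real k \<ge> (log 2 (2 * (real d + 6)) + 2 * log 2 (K + 1)) + 1 * log 2 b - 2 * log 2 \<delta>"
    have "log 2 (real d) \<ge> 0" using d by simp
    with b have b1: "b \<ge> 1" by simp
    \<comment> \<open>Chosen so that the failure probability K/N is at most \<delta>.\<close>
    define N where "N = nat \<lceil>K / \<delta>\<rceil>"
    have Kd: "K / \<delta> > 0" using K \<delta> by simp
    then have N: "N \<ge> 1" "K / \<delta> \<le> N" "real N \<le> K / \<delta> + 1" unfolding N_def by linarith+
    have "1 \<le> 1 / \<delta>" using \<delta> by simp
    then have "real N \<le> (K + 1) / \<delta>" using N(3) by (simp add: add_divide_distrib)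
    from iteration_count_suffices[OF N(1) b1 this \<delta>(1) _ k] K(1)
    have "2 * N * (d + 3 + N + nat \<lceil>b\<rceil>) \<le> 2 ^ k" by simp
    from K(2)[OF N(1) _ this] b1 have "measure M (success_set d k b) \<ge> 1 - K / N" by simp
    moreover have "K / N \<le> \<delta>" using N \<delta> by (simp add: field_simps)
    moreover have "{v \<in> space M. degree (poly_of_coeffs d v) = d \<and> graeffe_succeeds k b (poly_of_coeffs d v)} =
        success_set d k b"
      by (simp add: success_set_def sp)
    ultimately show "\<P>(v in M. degree (poly_of_coeffs d v) = d \<and> graeffe_succeeds k b (poly_of_coeffs d v)) \<ge> 1 - \<delta>"
      by simp
  qed
qed

end
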